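(* Let $f(t)=f_0(t)+f_1(t)\cos\theta(t)$, $t\in[0,1]$, be a signal that is periodic over $[0,1]$, with $f_1(t)>0$ and $\theta'(t)>0$ on $[0,1]$. Put $L=\frac{\theta(1)-\theta(0)}{2\pi}$ and $\bar\theta=\frac{\theta-\theta(0)}{2\pi L}$. Assume that the Fourier coefficients of the instantaneous frequency $\theta'$, the local mean $f_0$ and the envelope $f_1$ all have fast decay, i.e. there exist $C_0>0$ and $p\ge 4$ such that for $k\ne 0$ $$|\mathcal F(\theta')(k)|\le C_0|k|^{-p},\qquad |\mathcal F_\theta(f_0)(k)|\le C_0|k|^{-p},\qquad |\mathcal F_\theta(f_1)(k)|\le C_0|k|^{-p}.$$ Let $(\theta^m)_{m\ge 0}$ be the phase functions generated from the initial guess $\theta^0$ by the iteration described in the context, with smoothing parameter $M_0$. If $L$ is large enough and the initial guess satisfies $$\|\mathcal F((\theta^0-\theta)')\|_1\le \pi M_0/2,$$ then $$\|\mathcal F((\theta^{m+1}-\theta)')\|_1\le \Gamma_0 (L/4)^{-p+2}+\tfrac12 C_0M_0^{-p+1}+\tfrac12\,\|\mathcal F((\theta^{m}-\theta)')\|_1\qquad (m=0,1,2,\dots),$$ where $\Gamma_0>0$ is a constant determined by $C_0$, $M_0$ and $f_1$.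
   Context: Notation. For a function $g$ on $[0,1]$, $\mathcal F(g)(k)=\int_0^1 g(t)e^{-i2\pi kt}\,dt$, $k\in\mathbb Z$, and $\|\cdot\|_1$ of a coefficient sequence is its $\ell^1$ norm. $M_0$ is a positive integer chosen a priori; $V_{M_0}=\mathrm{span}\{e^{i2\pi kt}: k=-M_0,\dots,M_0\}$ and $P_{V_{M_0}}$ is the projection onto $V_{M_0}$. For an increasing phase function $\phi$ on $[0,1]$ put $L_\phi=\frac{\phi(1)-\phi(0)}{2\pi}$, $\bar\phi=\frac{\phi-\phi(0)}{2\pi L_\phi}$, and for a function $g$ on $[0,1]$ let $\mathcal F_\phi(g)(k)=\widehat g_{\phi}(k)=\int_0^1 g\,e^{-i2\pi k\bar\phi}\,d\bar\phi$. $L$ is the number of periods of the signal. Iteration (the signal is known for all $t\in[0,1]$ and Fourier transforms in the $\theta^m$-coordinate are exact). Given $\theta^m$, write $L^m=L_{\theta^m}$, let $\chi(x)=1$ for $-1/2<x<1/2$ and $\chi(x)=0$ otherwise, and set $$a(t)=\sum_{\omega\in\mathbb Z}\big(\widehat f_{\theta^m}(\omega+L^m)+\widehat f_{\theta^m}(\omega-L^m)\big)\chi(\omega/L^m)\,e^{i2\pi\omega\bar\theta^m(t)},$$ $$b(t)=\sum_{\omega\in\mathbb Z}(-i)\big(\widehat f_{\theta^m}(\omega+L^m)-\widehat f_{\theta^m}(\omega-L^m)\big)\chi(\omega/L^m)\,e^{i2\pi\omega\bar\theta^m(t)} .$$ Then $\Delta\theta'=P_{V_{M_0}}\big(\frac{d}{dt}\arctan(b/a)\big)$,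 $\Delta\theta(t)=\int_0^t\Delta\theta'(s)\,ds$, and $\theta^{m+1}=\theta^m+\beta\Delta\theta$ with $\beta=\max\{\alpha\in[0,1]:\frac{d}{dt}(\theta^m+\alpha\Delta\theta)\ge 0\}$.
   Formalization: The initial guess is additionally required to have derivative (θ^0)' in V_{M_0} and a whole number of periods L_{θ^0}, since the estimate fails without either; L is taken to be an integer, θ and θ^0 are C^1 with (θ^0)'>0, and f_0, f_1 are continuous. *)

theory Defs
  imports "HOL-Analysis.Analysis"
begin

text \<open>
  All functions are only looked at on \<open>[0,1]\<close>. Derivatives are taken within \<open>[0,1]\<close>, so they are
  one-sided at the two end points.
\<close>

definition deriv01 :: "(real \<Rightarrow> real) \<Rightarrow> real \<Rightarrow> real" where
  "deriv01 g t = vector_derivative g (at t within {0..1})"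

definition C1_01 :: "(real \<Rightarrow> real) \<Rightarrow> bool" where
  "C1_01 g \<longleftrightarrow> (\<forall>t\<in>{0..1}. g differentiable (at t within {0..1})) \<and> continuous_on {0..1} (deriv01 g)"

definition fourier :: "(real \<Rightarrow> complex) \<Rightarrow> int \<Rightarrow> complex" where
  "fourier g k = integral {0..1} (\<lambda>t. g t * cis (- (2 * pi * of_int k * t)))"

text \<open>Valued in \<open>[0,\<infinity>]\<close>, so that a bound on it includes summability.\<close>

definition l1_norm :: "(int \<Rightarrow> complex) \<Rightarrow> ennreal" where
  "l1_norm c = (\<Sum>\<^sub>\<infinity>k\<in>UNIV. ennreal (norm (c k)))"

definition trig_space :: "nat \<Rightarrow> (real \<Rightarrow> complex) set" where
  "trig_space M = {g. \<exists>c :: int \<Rightarrow> complex. g = (\<lambda>t. \<Sum>k = - int M..int M. c k * cis (2 * pi * of_int k * t))}"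

text \<open>
  The \<open>L\<^sup>2([0,1])\<close>-orthogonal projection onto \<^term>\<open>trig_space M\<close>, by its Fourier series formula;
  the lemmas \<open>trig_proj_in_trig_space\<close> and \<open>trig_proj_orthogonal\<close> justify the name.
\<close>

definition trig_proj :: "nat \<Rightarrow> (real \<Rightarrow> complex) \<Rightarrow> real \<Rightarrow> complex" where
  "trig_proj M g t = (\<Sum>k = - int M..int M. fourier g k * cis (2 * pi * of_int k * t))"

lemma trig_proj_in_trig_space: "trig_proj M g \<in> trig_space M"
  unfolding trig_space_def trig_proj_def by auto

lemma has_integral_cis:
  "((\<lambda>t. cis (2 * pi * of_int n * t)) has_integral (if n = 0 then 1 else 0)) {0..1}"
proof (cases "n = 0")
  case True
  then show ?thesis using has_integral_const_real[of "1 :: complex" 0 1] by simp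
next
  case False
  define w where "w = 2 * pi * of_int n"
  have w: "w \<noteq> 0" using False by (simp add: w_def)
  have "((\<lambda>t. cis (w * t) / (\<i> * of_real w)) has_vector_derivative cis (w * t)) (at t within {0..1})" for t
  proof -
    have "((\<lambda>z. exp (\<i> * of_real w * z) / (\<i> * of_real w)) has_field_derivative
        exp (\<i> * of_real w * of_real t)) (at (of_real t))"
      using w by (auto intro!: derivative_eq_intros)
    from has_vector_derivative_real_field[OF this] show ?thesis
      by (simp add: cis_conv_exp mult_ac)
  qed
  then have "((\<lambda>t. cis (w * t)) has_integral
      (cis (w * 1) / (\<i> * of_real w) - cis (w * 0) / (\<i> * of_real w))) {0..1}"
    by (intro fundamental_theorem_of_calculus) auto
  moreover have "cis w = 1" unfolding w_def using cis_multiple_2pi[of "of_int n"] by simp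
  ultimately show ?thesis using False by (simp add: w_def)
qed

lemma trig_proj_orthogonal:
  assumes "\<And>k. (\<lambda>t. g t * cis (- (2 * pi * of_int k * t))) integrable_on {0..1}"
    and "u \<in> trig_space M"
  shows "integral {0..1} (\<lambda>t. (g t - trig_proj M g t) * cnj (u t)) = 0"
proof -
  obtain c where u: "u = (\<lambda>t. \<Sum>k = - int M..int M. c k * cis (2 * pi * of_int k * t))"
    using assms(2) by (auto simp: trig_space_def)
  have g: "((\<lambda>t. g t * cis (- (2 * pi * of_int k * t))) has_integral fourier g k) {0..1}" for k
    unfolding fourier_def using assms(1) by (rule integrable_integral)
  have P: "((\<lambda>t. trig_proj M g t * cis (- (2 * pi * of_int k * t))) has_integral fourier g k) {0..1}"
    if "k \<in> {- int M..int M}" for k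
  proof -
    have "((\<lambda>t. \<Sum>j = - int M..int M. fourier g j * cis (2 * pi * of_int (j - k) * t)) has_integral
        (\<Sum>j = - int M..int M. fourier g j * (if j - k = 0 then 1 else 0))) {0..1}"
      by (intro has_integral_sum has_integral_mult_right has_integral_cis) auto
    moreover have "(\<Sum>j = - int M..int M. fourier g j * (if j - k = 0 then 1 else 0)) = fourier g k"
      using that by (simp add: sum.delta if_distrib cong: if_cong)
    moreover have "(\<Sum>j = - int M..int M. fourier g j * cis (2 * pi * of_int (j - k) * t))
        = trig_proj M g t * cis (- (2 * pi * of_int k * t))" for t
      unfolding trig_proj_def sum_distrib_right
      by (intro sum.cong refl) (simp add: mult.assoc cis_mult algebra_simps)
    ultimately show ?thesis by simp
  qed
  have "((\<lambda>t. \<Sum>k = - int M..int M. cnj (c k) * (g t * cis (- (2 * pi * of_int k * t))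
      - trig_proj M g t * cis (- (2 * pi * of_int k * t)))) has_integral
      (\<Sum>k = - int M..int M. cnj (c k) * (fourier g k - fourier g k))) {0..1}"
    by (intro has_integral_sum has_integral_mult_right has_integral_diff g P) auto
  moreover have "(\<Sum>k = - int M..int M. cnj (c k) * (g t * cis (- (2 * pi * of_int k * t))
      - trig_proj M g t * cis (- (2 * pi * of_int k * t)))) = (g t - trig_proj M g t) * cnj (u t)" for t
    unfolding u cnj_sum sum_distrib_left
    by (intro sum.cong refl) (simp add: cis_cnj algebra_simps)
  ultimately show ?thesis by (simp add: integral_unique)
qed

definition num_periods :: "(real \<Rightarrow> real) \<Rightarrow> real" where
  "num_periods \<phi> = (\<phi> 1 - \<phi> 0) / (2 * pi)"

definition normalized_phase :: "(real \<Rightarrow> real) \<Rightarrow> real \<Rightarrow> real" where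
  "normalized_phase \<phi> t = (\<phi> t - \<phi> 0) / (2 * pi * num_periods \<phi>)"

text \<open>
  The integral with respect to \<open>d\<phi>\<close> (normalized phase) is written out with the density
  \<open>\<phi>'\<close>. The frequency argument is real because it is used at \<open>\<omega> \<plusminus> L\<close>.
\<close>

definition phase_fourier :: "(real \<Rightarrow> real) \<Rightarrow> (real \<Rightarrow> real) \<Rightarrow> real \<Rightarrow> complex" where
  "phase_fourier \<phi> g x = integral {0..1} (\<lambda>t. of_real (g t) * cis (- (2 * pi * x * normalized_phase \<phi> t))
      * of_real (deriv01 (normalized_phase \<phi>) t))"

definition chi :: "real \<Rightarrow> real" where
  "chi x = (if - (1/2) < x \<and> x < 1/2 then 1 else 0)"

text \<open>
  The series below have only finitely many nonzero terms when \<open>num_periods \<phi> > 0\<close>. When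
  \<open>num_periods \<phi>\<close> is moreover an integer, the terms at \<open>\<omega>\<close> and \<open>-\<omega>\<close> are complex conjugates,
  so that the sums are real and \<open>Re\<close> only changes the type.
\<close>

definition env_cos :: "(real \<Rightarrow> real) \<Rightarrow> (real \<Rightarrow> real) \<Rightarrow> real \<Rightarrow> real" where
  "env_cos f \<phi> t = Re (\<Sum>\<^sub>\<infinity>\<omega>\<in>(UNIV :: int set).
     (phase_fourier \<phi> f (of_int \<omega> + num_periods \<phi>) + phase_fourier \<phi> f (of_int \<omega> - num_periods \<phi>))
     * of_real (chi (of_int \<omega> / num_periods \<phi>)) * cis (2 * pi * of_int \<omega> * normalized_phase \<phi> t))"

definition env_sin :: "(real \<Rightarrow> real) \<Rightarrow> (real \<Rightarrow> real) \<Rightarrow> real \<Rightarrow> real" where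
  "env_sin f \<phi> t = Re (\<Sum>\<^sub>\<infinity>\<omega>\<in>(UNIV :: int set).
     - \<i> * (phase_fourier \<phi> f (of_int \<omega> + num_periods \<phi>) - phase_fourier \<phi> f (of_int \<omega> - num_periods \<phi>))
     * of_real (chi (of_int \<omega> / num_periods \<phi>)) * cis (2 * pi * of_int \<omega> * normalized_phase \<phi> t))"

text \<open>The projection of a real function is real, so again \<open>Re\<close> only changes the type.\<close>

definition phase_incr_deriv :: "nat \<Rightarrow> (real \<Rightarrow> real) \<Rightarrow> (real \<Rightarrow> real) \<Rightarrow> real \<Rightarrow> real" where
  "phase_incr_deriv M f \<phi> t =
     Re (trig_proj M (\<lambda>s. of_real (deriv01 (\<lambda>r. arctan (env_sin f \<phi> r / env_cos f \<phi> r)) s)) t)"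

definition phase_incr :: "nat \<Rightarrow> (real \<Rightarrow> real) \<Rightarrow> (real \<Rightarrow> real) \<Rightarrow> real \<Rightarrow> real" where
  "phase_incr M f \<phi> t = integral {0..t} (phase_incr_deriv M f \<phi>)"

definition step_size :: "nat \<Rightarrow> (real \<Rightarrow> real) \<Rightarrow> (real \<Rightarrow> real) \<Rightarrow> real" where
  "step_size M f \<phi> = (GREATEST \<alpha>. \<alpha> \<in> {0..1} \<and>
     (\<forall>t\<in>{0..1}. deriv01 (\<lambda>s. \<phi> s + \<alpha> * phase_incr M f \<phi> s) t \<ge> 0))"

definition next_phase :: "nat \<Rightarrow> (real \<Rightarrow> real) \<Rightarrow> (real \<Rightarrow> real) \<Rightarrow> real \<Rightarrow> real" where
  "next_phase M f \<phi> t = \<phi> t + step_size M f \<phi> * phase_incr M f \<phi> t"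

definition phase_iter :: "nat \<Rightarrow> (real \<Rightarrow> real) \<Rightarrow> (real \<Rightarrow> real) \<Rightarrow> nat \<Rightarrow> real \<Rightarrow> real" where
  "phase_iter M f \<theta>0 m = (next_phase M f ^^ m) \<theta>0"

text \<open>
  Phase functions to which the iteration with smoothing parameter \<open>M\<close> applies: increasing, with
  frequency \<open>\<phi>'\<close> in \<^term>\<open>trig_space M\<close> (the update never touches the other Fourier modes), and with
  a whole number of periods (so that \<open>\<omega> \<plusminus> num_periods \<phi>\<close> are integer frequencies).
\<close>

definition initial_phase :: "nat \<Rightarrow> (real \<Rightarrow> real) \<Rightarrow> bool" where
  "initial_phase M \<phi> \<longleftrightarrow> C1_01 \<phi> \<and> (\<forall>t\<in>{0..1}. deriv01 \<phi> t > 0) \<and>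
     (\<exists>v\<in>trig_space M. \<forall>t\<in>{0..1}. of_real (deriv01 \<phi> t) = v t) \<and> num_periods \<phi> \<in> \<nat>"

text \<open>\<open>\<parallel>\<F>((\<phi> - \<theta>)')\<parallel>\<^sub>1\<close>\<close>

definition freq_error :: "(real \<Rightarrow> real) \<Rightarrow> (real \<Rightarrow> real) \<Rightarrow> ennreal" where
  "freq_error \<phi> \<theta> = l1_norm (fourier (\<lambda>t. of_real (deriv01 (\<lambda>s. \<phi> s - \<theta> s) t)))"

end

theory Submission
  imports Defs
begin

text \<open>
  Write \<open>N\<close> for the number of periods of the current phase \<open>\<phi>\<close>. In the normalized phase
  coordinate of \<open>\<phi>\<close> the signal is \<open>f0 + Re (G e\<^sub>N)\<close>, where \<open>e\<^sub>N\<close> is the mode of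
  frequency \<open>N\<close> and \<open>G = f1 cis \<psi>\<close> with \<open>\<psi> = \<theta> - \<phi> + \<phi> 0\<close>.
  Shifting by \<open>N\<close> and cutting at \<open>N / 2\<close> yields \<open>z = a + i b\<close>, which differs from \<open>G\<close>
  only by Fourier modes of \<open>f0\<close> and \<open>G\<close> beyond \<open>N / 2\<close>. Both functions are \<open>C\<^sup>1\<close>
  and periodic with bounds independent of \<open>L\<close>, so by Bessel's inequality \<open>z - G\<close> is uniformly
  \<open>O(1 / sqrt L)\<close>. As \<open>f1\<close> is bounded below, the argument \<open>E\<close> of \<open>z / G\<close> is small and
  periodic, and the derivative of \<open>arctan (b / a)\<close> is \<open>\<psi>' + E'\<close>: its low Fourier modes are those of
  \<open>\<theta>' - \<phi>'\<close> up to \<open>O(1 / sqrt L)\<close>, and its mean is exact. Hence after one step the error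
  consists of the modes of \<open>\<theta>'\<close> beyond \<open>M0\<close> and a low-frequency part that tends to 0.
  These high modes have norm at most \<open>2/3 C0 M0 powr (1 - p)\<close>, and they are also part of
  the previous error since \<open>\<phi>'\<close> has no such modes. Averaging the two bounds leaves room
  \<open>1/6 C0 M0 powr (1 - p)\<close> for the low-frequency part, so that even \<open>\<Gamma>0 = 1\<close> works once
  \<open>L\<close> is large.
\<close>

section \<open>Fourier coefficients in a phase coordinate\<close>

text \<open>The locale serves three coordinates: the normalized phase of \<open>\<theta>\<close>,
  that of the current iterate, and the identity, where \<open>coef\<close> becomes
  \<open>fourier\<close>. Keeping the density \<open>u'\<close> explicit avoids inverting
  \<open>u\<close>.\<close>

locale phase_coordinate =
  fixes u u' :: "real \<Rightarrow> real"
  assumes at_0: "u 0 = 0" and at_1: "u 1 = 1"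
    and deriv: "\<And>t. t \<in> {0..1} \<Longrightarrow> (u has_real_derivative u' t) (at t within {0..1})"
    and deriv_cont [continuous_intros]: "continuous_on {0..1} u'"
    and deriv_pos: "\<And>t. t \<in> {0..1} \<Longrightarrow> 0 < u' t"
begin

definition mode :: "int \<Rightarrow> real \<Rightarrow> complex" where
  "mode k t = cis (2 * pi * of_int k * u t)"

definition coef :: "(real \<Rightarrow> complex) \<Rightarrow> int \<Rightarrow> complex" where
  "coef g k = integral {0..1} (\<lambda>t. g t * mode (- k) t * of_real (u' t))"

lemma cont [continuous_intros]: "continuous_on {0..1} u"
  using deriv by (rule DERIV_continuous_on)

lemma mode_cont [continuous_intros]: "continuous_on {0..1} (mode k)"
  unfolding mode_def by (intro continuous_intros)

lemma norm_mode [simp]: "norm (mode k t) = 1"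
  by (simp add: mode_def)

lemma mode_0 [simp]: "mode 0 t = 1"
  by (simp add: mode_def)

lemma mode_mult: "mode j t * mode k t = mode (j + k) t"
  by (simp add: mode_def cis_mult algebra_simps)

lemma cnj_mode: "cnj (mode k t) = mode (- k) t"
  by (simp add: mode_def cis_cnj)

lemma mode_at_0 [simp]: "mode k 0 = 1" and mode_at_1 [simp]: "mode k 1 = 1"
  using cis_multiple_2pi[of "of_int k"] by (simp_all add: mode_def at_0 at_1)

lemma mode_deriv:
  assumes "t \<in> {0..1}"
  shows "(mode k has_vector_derivative 2 * pi * \<i> * of_int k * mode k t * of_real (u' t)) (at t within {0..1})"
proof -
  have "((\<lambda>t. 2 * pi * of_int k * u t) has_real_derivative 2 * pi * of_int k * u' t) (at t within {0..1})"
    using deriv[OF assms] by (intro DERIV_cmult)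
  then have "((\<lambda>t. cis (2 * pi * of_int k * u t)) has_derivative
      (\<lambda>h. (2 * pi * of_int k * u' t * h) *\<^sub>R (\<i> * cis (2 * pi * of_int k * u t)))) (at t within {0..1})"
    by (intro has_derivative_cis) (simp add: has_field_derivative_def)
  then show ?thesis
    unfolding mode_def has_vector_derivative_def
    by (rule has_derivative_eq_rhs) (auto simp: fun_eq_iff scaleR_conv_of_real mult_ac)
qed

lemma coef_integrable:
  assumes "continuous_on {0..1} g"
  shows "((\<lambda>t. g t * mode (- k) t * of_real (u' t)) has_integral coef g k) {0..1}"
  unfolding coef_def
  by (intro integrable_integral integrable_continuous_interval continuous_intros assms)

lemma integral_mode:
  "((\<lambda>t. mode k t * of_real (u' t)) has_integral (if k = 0 then 1 else 0)) {0..1}"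
proof (cases "k = 0")
  case True
  have "((\<lambda>t. of_real (u' t) :: complex) has_integral of_real (u 1 - u 0)) {0..1}"
    using deriv by (intro has_integral_of_real fundamental_theorem_of_calculus)
      (auto simp: has_real_derivative_iff_has_vector_derivative)
  then show ?thesis using True by (simp add: at_0 at_1)
next
  case False
  have "((\<lambda>t. mode k t / (2 * pi * \<i> * of_int k)) has_vector_derivative
      mode k t * of_real (u' t)) (at t within {0..1})" if "t \<in> {0..1}" for t
    using has_vector_derivative_divide[OF mode_deriv[OF that, of k], of "2 * pi * \<i> * of_int k"] False
    by (simp add: field_simps)
  then have "((\<lambda>t. mode k t * of_real (u' t)) has_integral
      mode k 1 / (2 * pi * \<i> * of_int k) - mode k 0 / (2 * pi * \<i> * of_int k)) {0..1}"
    by (intro fundamental_theorem_of_calculus) auto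
  then show ?thesis using False by simp
qed

lemma coef_mode: "coef (mode j) k = (if j = k then 1 else 0)"
  using integral_mode[of "j - k"] unfolding coef_def mode_mult by (simp add: integral_unique)

text \<open>Integrate the nonnegative function |g - P|^2 \<open>u'\<close>, with \<open>P\<close>
  the partial sum over \<open>K\<close>. By orthonormality of the modes, both mixed integrals and
  that of |P|^2 equal \<open>S\<close>, so the total is \<open>I - S\<close>.\<close>

lemma bessel:
  assumes g: "continuous_on {0..1} g" and K: "finite K"
  shows "(\<Sum>k\<in>K. (cmod (coef g k))\<^sup>2) \<le> integral {0..1} (\<lambda>t. (cmod (g t))\<^sup>2 * u' t)"
proof -
  define c where "c = coef g"
  define P where "P t = (\<Sum>k\<in>K. c k * mode k t)" for t
  define S where "S = (\<Sum>k\<in>K. c k * cnj (c k))"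
  define I where "I = integral {0..1} (\<lambda>t. (cmod (g t))\<^sup>2 * u' t)"
  have P_cont: "continuous_on {0..1} P"
    unfolding P_def by (intro continuous_intros)
  have gg: "((\<lambda>t. complex_of_real ((cmod (g t))\<^sup>2 * u' t)) has_integral of_real I) {0..1}"
    unfolding I_def
    by (intro has_integral_of_real integrable_integral integrable_continuous_interval continuous_intros g)
  have *: "((\<lambda>t. h t * cnj (P t) * of_real (u' t)) has_integral (\<Sum>k\<in>K. coef h k * cnj (c k))) {0..1}"
    if h: "continuous_on {0..1} h" for h
  proof -
    have "((\<lambda>t. \<Sum>k\<in>K. (h t * mode (- k) t * of_real (u' t)) * cnj (c k)) has_integral
        (\<Sum>k\<in>K. coef h k * cnj (c k))) {0..1}"
      by (intro has_integral_sum has_integral_mult_left coef_integrable h K)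
    then show ?thesis
      by (simp add: P_def cnj_sum sum_distrib_left sum_distrib_right cnj_mode mult_ac)
  qed
  have coef_P: "coef P k = c k" if "k \<in> K" for k
  proof -
    have "((\<lambda>t. \<Sum>j\<in>K. c j * (mode j t * mode (- k) t * of_real (u' t))) has_integral
        (\<Sum>j\<in>K. c j * coef (mode j) k)) {0..1}"
      by (intro has_integral_sum has_integral_mult_right coef_integrable mode_cont K)
    then have "coef P k = (\<Sum>j\<in>K. c j * coef (mode j) k)"
      unfolding coef_def[of P] P_def
      by (intro integral_unique) (simp add: sum_distrib_left sum_distrib_right mult_ac)
    also have "\<dots> = c k" using that K by (simp add: coef_mode if_distrib sum.delta cong: if_cong)
    finally show ?thesis .
  qed
  have gP: "((\<lambda>t. g t * cnj (P t) * of_real (u' t)) has_integral S) {0..1}"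
    using *[OF g] by (simp add: S_def c_def)
  have PP: "((\<lambda>t. P t * cnj (P t) * of_real (u' t)) has_integral S) {0..1}"
    using *[OF P_cont] by (simp add: S_def coef_P)
  have Pg: "((\<lambda>t. cnj (g t * cnj (P t) * of_real (u' t))) has_integral cnj S) {0..1}"
    using has_integral_cnj[of "\<lambda>t. g t * cnj (P t) * of_real (u' t)" S "{0..1}"] gP by (simp add: o_def)
  have S_real: "cnj S = S" by (simp add: S_def cnj_sum mult_ac)
  have "((\<lambda>t. complex_of_real ((cmod (g t))\<^sup>2 * u' t) - g t * cnj (P t) * of_real (u' t)
      - cnj (g t * cnj (P t) * of_real (u' t)) + P t * cnj (P t) * of_real (u' t))
      has_integral of_real I - S - cnj S + S) {0..1}"
    by (intro has_integral_add has_integral_diff gg gP Pg PP)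
  moreover have "complex_of_real ((cmod (g t))\<^sup>2 * u' t) - g t * cnj (P t) * of_real (u' t)
      - cnj (g t * cnj (P t) * of_real (u' t)) + P t * cnj (P t) * of_real (u' t)
      = complex_of_real ((cmod (g t - P t))\<^sup>2 * u' t)" for t
    by (simp only: of_real_mult complex_norm_square complex_cnj_mult complex_cnj_diff complex_cnj_cnj
      complex_cnj_complex_of_real) (simp add: algebra_simps)
  ultimately have "((\<lambda>t. complex_of_real ((cmod (g t - P t))\<^sup>2 * u' t)) has_integral of_real I - S) {0..1}"
    using S_real by simp
  from has_integral_Re[OF this]
  have "((\<lambda>t. (cmod (g t - P t))\<^sup>2 * u' t) has_integral I - Re S) {0..1}" by simp
  moreover have "0 \<le> (cmod (g t - P t))\<^sup>2 * u' t" if "t \<in> {0..1}" for t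
    using deriv_pos[OF that] by simp
  ultimately have "0 \<le> I - Re S" by (rule has_integral_nonneg)
  moreover have "Re S = (\<Sum>k\<in>K. (cmod (c k))\<^sup>2)"
    unfolding S_def Re_sum by (simp add: complex_norm_square[symmetric] flip: of_real_power)
  ultimately show ?thesis by (simp add: I_def c_def)
qed

section \<open>Uniqueness of the coefficients of a continuous function\<close>

lemma strict_mono_u: "strict_mono_on {0..1} u"
proof (rule strict_mono_onI)
  fix r s :: real assume rs: "r \<in> {0..1}" "s \<in> {0..1}" "r < s"
  have "\<exists>y. (u has_real_derivative y) (at x) \<and> 0 < y" if "r < x" "x < s" for x
    using that rs deriv[of x] deriv_pos[of x] at_within_Icc_at[of 0 x 1] by (intro exI[of _ "u' x"]) auto
  moreover have "continuous_on {r..s} u"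
    using rs by (intro continuous_on_subset[OF cont]) auto
  ultimately show "u r < u s"
    using DERIV_pos_imp_increasing_open[OF \<open>r < s\<close>, of u] by blast
qed

lemma u_less_iff: "s \<in> {0..1} \<Longrightarrow> t \<in> {0..1} \<Longrightarrow> u s < u t \<longleftrightarrow> s < t"
  using strict_mono_on_less[OF strict_mono_u] .

lemma u_le_iff: "s \<in> {0..1} \<Longrightarrow> t \<in> {0..1} \<Longrightarrow> u s \<le> u t \<longleftrightarrow> s \<le> t"
  using strict_mono_on_less_eq[OF strict_mono_u] .

lemma u_range: "t \<in> {0..1} \<Longrightarrow> u t \<in> {0..1}"
  using u_le_iff[of 0 t] u_le_iff[of t 1] by (simp add: at_0 at_1)

text \<open>A factor of degree one only combines the coefficients at k - 1, k and k + 1, so the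
  vanishing of all coefficients survives each multiplication.\<close>

lemma coef_mult_trig_power_eq_0:
  assumes g: "continuous_on {0..1} g" and 0: "\<And>k. coef g k = 0"
  shows "coef (\<lambda>t. g t * (\<alpha> + \<beta> * mode 1 t + \<gamma> * mode (- 1) t) ^ n) k = 0"
proof (induction n arbitrary: k)
  case 0
  then show ?case using assms(2) by simp
next
  case (Suc n)
  let ?T = "\<lambda>t. \<alpha> + \<beta> * mode 1 t + \<gamma> * mode (- 1) t"
  let ?h = "\<lambda>t. g t * ?T t ^ n"
  have h: "continuous_on {0..1} ?h" by (intro continuous_intros g)
  have "((\<lambda>t. \<alpha> * (?h t * mode (- k) t * of_real (u' t))
       + \<beta> * (?h t * mode (- (k - 1)) t * of_real (u' t))
       + \<gamma> * (?h t * mode (- (k + 1)) t * of_real (u' t))) has_integral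
       \<alpha> * coef ?h k + \<beta> * coef ?h (k - 1) + \<gamma> * coef ?h (k + 1)) {0..1}"
    by (intro has_integral_add has_integral_mult_right coef_integrable h)
  moreover have "\<alpha> * (?h t * mode (- k) t * of_real (u' t))
       + \<beta> * (?h t * mode (- (k - 1)) t * of_real (u' t))
       + \<gamma> * (?h t * mode (- (k + 1)) t * of_real (u' t))
       = g t * ?T t ^ Suc n * mode (- k) t * of_real (u' t)" for t
  proof -
    have "mode (- (k - 1)) t = mode 1 t * mode (- k) t" "mode (- (k + 1)) t = mode (- 1) t * mode (- k) t"
      by (simp_all add: mode_mult algebra_simps)
    then show ?thesis by (simp add: algebra_simps)
  qed
  ultimately have "((\<lambda>t. g t * ?T t ^ Suc n * mode (- k) t * of_real (u' t)) has_integral 0) {0..1}"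
    using Suc.IH by simp
  then show ?case unfolding coef_def by (rule integral_unique)
qed

text \<open>
  If \<open>g\<close> does not vanish at \<open>t0\<close>, then the powers of a trigonometric polynomial that exceeds
  1 in modulus only near \<open>t0\<close> have unbounded integrals against \<open>g\<close>.
\<close>

lemma eq_0_if_coef_eq_0_interior:
  assumes g: "continuous_on {0..1} g" and 0: "\<And>k. coef g k = 0" and t0: "t0 \<in> {0<..<1}"
  shows "g t0 = 0"
proof (rule ccontr)
  assume nz: "g t0 \<noteq> 0"
  define r where "r t = Re (g t * cnj (g t0))" for t
  have r_cont: "continuous_on {0..1} r" unfolding r_def by (intro continuous_intros g)
  define r0 where "r0 = r t0"
  have "r0 = (cmod (g t0))\<^sup>2" unfolding r0_def r_def by (simp add: complex_mult_cnj cmod_power2)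
  then have r0: "r0 > 0" using nz by simp
  have "\<exists>d>0. \<forall>t\<in>{0..1}. dist t t0 < d \<longrightarrow> dist (r t) (r t0) < r0 / 2"
    using r_cont[unfolded continuous_on_iff, rule_format, of t0 "r0 / 2"] t0 r0 by auto
  then obtain d where d: "d > 0" "\<And>t. t \<in> {0..1} \<Longrightarrow> \<bar>t - t0\<bar> < d \<Longrightarrow> \<bar>r t - r0\<bar> < r0 / 2"
    by (auto simp: dist_real_def r0_def)
  \<comment> \<open>The two minima keep the interval around \<open>t0\<close> inside the
    neighbourhood of radius \<open>d\<close> and strictly inside (0,1).\<close>
  define e where "e = min (d / 2) (min t0 (1 - t0) / 2)"
  have e: "e > 0" "e < d" "e < t0" "e < 1 - t0"
    using d(1) t0 by (auto simp: e_def min_def)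
  define s1 where "s1 = t0 - e"
  define s2 where "s2 = t0 + e"
  have s: "0 < s1" "s1 < t0" "t0 < s2" "s2 < 1" using e t0 by (auto simp: s1_def s2_def)
  have r_lower: "r t \<ge> r0 / 2" if "t \<in> {s1..s2}" for t
  proof -
    have "\<bar>t - t0\<bar> < d" using that e by (auto simp: s1_def s2_def)
    then have "\<bar>r t - r0\<bar> < r0 / 2" using that s by (intro d(2)) auto
    then show ?thesis by linarith
  qed
  \<comment> \<open>Midpoint and half-width of the image interval under \<open>u\<close>. The
    half-width is below 1/2, so 2 pi \<open>\<rho>\<close> stays in the range where the cosine
    decreases.\<close>
  define x where "x = (u s1 + u s2) / 2"
  define \<rho> where "\<rho> = (u s2 - u s1) / 2"
  have us: "0 < u s1" "u s1 < u s2" "u s2 < 1"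
    using s u_less_iff[of 0 s1] u_less_iff[of s1 s2] u_less_iff[of s2 1] by (auto simp: at_0 at_1)
  then have \<rho>: "0 < \<rho>" "\<rho> < 1 / 2" "x - \<rho> = u s1" "x + \<rho> = u s2"
    by (auto simp: \<rho>_def x_def field_simps)
  \<comment> \<open>\<open>T\<close> is 1 where \<open>u\<close> has distance \<open>\<rho>\<close>
    from \<open>x\<close>, larger inside that arc, and between -1 and 1 outside. On the arc of
    radius \<open>\<rho> / 2\<close> it exceeds 1 by at least \<open>\<kappa>\<close>.\<close>
  define T where "T t = 1 + cos (2 * pi * (u t - x)) - cos (2 * pi * \<rho>)" for t
  define \<kappa> where "\<kappa> = cos (pi * \<rho>) - cos (2 * pi * \<rho>)"
  have \<kappa>: "\<kappa> > 0" unfolding \<kappa>_def using \<rho> by (auto intro!: cos_monotone_0_pi simp: field_simps)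
  have u_cont: "continuous_on {s1..s2} u" using s by (intro continuous_on_subset[OF cont]) auto
  obtain a where a: "s1 \<le> a" "a \<le> s2" "u a = x - \<rho> / 2"
    using IVT'[of u s1 "x - \<rho> / 2" s2, OF _ _ _ u_cont] \<rho> s by auto
  obtain b where b: "s1 \<le> b" "b \<le> s2" "u b = x + \<rho> / 2"
    using IVT'[of u s1 "x + \<rho> / 2" s2, OF _ _ _ u_cont] \<rho> s by auto
  have ab: "a < b" using u_less_iff[of a b] a b s \<rho> by auto
  have T_inner: "T t \<ge> 1 + \<kappa>" if "t \<in> {a..b}" for t
  proof -
    have t: "t \<in> {0..1}" using that a b s by auto
    have "\<bar>u t - x\<bar> \<le> \<rho> / 2"
      using u_le_iff[of a t] u_le_iff[of t b] that a b s t by (auto simp: abs_if)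
    then have "2 * pi * \<bar>u t - x\<bar> \<le> pi * \<rho>" using pi_gt_zero by (simp add: field_simps)
    moreover have "pi * \<rho> \<le> pi" using \<rho> by (simp add: mult_left_le)
    ultimately have "cos (pi * \<rho>) \<le> cos (2 * pi * \<bar>u t - x\<bar>)"
      by (intro cos_monotone_0_pi_le) auto
    also have "\<dots> = cos (2 * pi * (u t - x))" by (cases "u t - x \<ge> 0") (auto simp: abs_if algebra_simps cos_diff)
    finally show ?thesis by (simp add: T_def \<kappa>_def)
  qed
  have T_mid: "T t \<ge> 0" if "t \<in> {s1..s2}" for t
  proof -
    have t: "t \<in> {0..1}" using that s by auto
    have "\<bar>u t - x\<bar> \<le> \<rho>"
      using u_le_iff[of s1 t] u_le_iff[of t s2] that s t \<rho> by (auto simp: abs_if)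
    then have "2 * pi * \<bar>u t - x\<bar> \<le> 2 * pi * \<rho>" using pi_gt_zero by (simp add: field_simps)
    moreover have "2 * pi * \<rho> \<le> pi" using \<rho> by (simp add: field_simps)
    ultimately have "cos (2 * pi * \<rho>) \<le> cos (2 * pi * \<bar>u t - x\<bar>)"
      by (intro cos_monotone_0_pi_le) auto
    also have "\<dots> = cos (2 * pi * (u t - x))" by (cases "u t - x \<ge> 0") (auto simp: abs_if algebra_simps cos_diff)
    finally show ?thesis by (simp add: T_def)
  qed
  have T_outer: "\<bar>T t\<bar> \<le> 1" if t: "t \<in> {0..1}" "t \<notin> {s1..s2}" for t
  proof -
    have "\<bar>u t - x\<bar> \<ge> \<rho>" "\<bar>u t - x\<bar> \<le> 1 - \<rho>"
      using u_less_iff[of t s1] u_less_iff[of s2 t] that s u_range[of t] us \<rho> by (auto simp: abs_if)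
    then have *: "2 * pi * \<bar>u t - x\<bar> \<ge> 2 * pi * \<rho>" "2 * pi * \<bar>u t - x\<bar> \<le> 2 * pi * (1 - \<rho>)"
      by (auto intro!: mult_left_mono)
    have "cos (2 * pi * \<bar>u t - x\<bar>) \<le> cos (2 * pi * \<rho>)"
    proof (cases "2 * pi * \<bar>u t - x\<bar> \<le> pi")
      case True
      then show ?thesis using * \<rho> by (intro cos_monotone_0_pi_le) auto
    next
      case False
      \<comment> \<open>Beyond pi the angle is reflected. As the distance from \<open>x\<close> is
        at most \<open>1 - \<rho>\<close>, the reflected angle is still at least 2 pi
        \<open>\<rho>\<close>.\<close>
      have "cos (2 * pi * \<bar>u t - x\<bar>) = cos (2 * pi - 2 * pi * \<bar>u t - x\<bar>)" by (simp add: cos_diff)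
      also have "\<dots> \<le> cos (2 * pi * \<rho>)"
        using * \<rho> False by (intro cos_monotone_0_pi_le) (auto simp: algebra_simps)
      finally show ?thesis .
    qed
    moreover have "cos (2 * pi * \<bar>u t - x\<bar>) = cos (2 * pi * (u t - x))"
      by (cases "u t - x \<ge> 0") (auto simp: abs_if algebra_simps cos_diff)
    moreover have "cos (2 * pi * (u t - x)) \<ge> -1" "cos (2 * pi * \<rho>) \<le> 1" by auto
    ultimately show ?thesis unfolding T_def by linarith
  qed
  have T_modes: "of_real (T t) = of_real (1 - cos (2 * pi * \<rho>)) + cis (- (2 * pi * x)) / 2 * mode 1 t
      + cis (2 * pi * x) / 2 * mode (- 1) t" for t
  proof -
    have "cis (- (2 * pi * x)) * mode 1 t = cis (2 * pi * (u t - x))"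
      "cis (2 * pi * x) * mode (- 1) t = cis (- (2 * pi * (u t - x)))"
      by (simp_all add: mode_def cis_mult algebra_simps)
    then have "cis (- (2 * pi * x)) / 2 * mode 1 t + cis (2 * pi * x) / 2 * mode (- 1) t
        = of_real (cos (2 * pi * (u t - x)))"
      by (simp add: complex_eq_iff)
    then show ?thesis by (simp add: T_def algebra_simps)
  qed
  have zero: "((\<lambda>t. r t * T t ^ n * u' t) has_integral 0) {0..1}" for n
  proof -
    have "continuous_on {0..1} (\<lambda>t. g t * of_real (T t) ^ n)"
      unfolding T_def by (intro continuous_intros g)
    moreover have "coef (\<lambda>t. g t * of_real (T t) ^ n) 0 = 0"
      unfolding T_modes by (rule coef_mult_trig_power_eq_0[OF g 0])
    ultimately have "((\<lambda>t. g t * of_real (T t) ^ n * mode (- 0) t * of_real (u' t)) has_integral 0) {0..1}"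
      by (metis coef_integrable)
    from has_integral_Re[OF has_integral_mult_right[OF this, of "cnj (g t0)"]]
    show ?thesis by (simp add: r_def algebra_simps flip: of_real_power of_real_mult)
  qed
  have "continuous_on {0..1} (\<lambda>t. \<bar>r t * u' t\<bar>)" by (intro continuous_intros r_cont)
  then obtain y0 where "\<forall>t\<in>{0..1}. \<bar>r t * u' t\<bar> \<le> \<bar>r y0 * u' y0\<bar>"
    using continuous_attains_sup[of "{0..1::real}" "\<lambda>t. \<bar>r t * u' t\<bar>"] by auto
  then obtain B where B: "\<And>t. t \<in> {0..1} \<Longrightarrow> \<bar>r t * u' t\<bar> \<le> B" by blast
  have "B \<ge> 0" using B[of 0] by auto
  obtain y where y: "y \<in> {0..1}" "\<And>t. t \<in> {0..1} \<Longrightarrow> u' y \<le> u' t"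
    using continuous_attains_inf[of "{0..1}" u'] deriv_cont by auto
  have m: "u' y > 0" using y deriv_pos by auto
  \<comment> \<open>On [a, b] the integrand is at least a geometrically growing constant, on the
    rest of [s1, s2] it is nonnegative, and elsewhere it is at least -B. Since the integral is 0,
    the growing part would stay below \<open>B\<close> for every n.\<close>
  have bound: "r0 / 2 * (1 + \<kappa>) ^ n * u' y * (b - a) \<le> B" for n
  proof -
    let ?Q = "r0 / 2 * (1 + \<kappa>) ^ n * u' y"
    have "((\<lambda>t. if t \<in> {a..b} then ?Q else 0) has_integral ?Q * (b - a)) {0..1}"
      using has_integral_const_real[of ?Q a b] ab a b s
      by (subst has_integral_restrict) (auto simp: mult_ac)
    moreover have "((\<lambda>t. r t * T t ^ n * u' t + B) has_integral 0 + B) {0..1}"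
      using has_integral_const_real[of B 0 1] by (intro has_integral_add zero) simp
    moreover have "(if t \<in> {a..b} then ?Q else 0) \<le> r t * T t ^ n * u' t + B" if t: "t \<in> {0..1}" for t
    proof -
      consider "t \<in> {a..b}" | "t \<in> {s1..s2}" "t \<notin> {a..b}" | "t \<notin> {s1..s2}" "t \<notin> {a..b}" by blast
      then show ?thesis
      proof cases
        case 1
        then have "r t \<ge> r0 / 2" using a b by (intro r_lower) auto
        moreover have "T t ^ n \<ge> (1 + \<kappa>) ^ n" using T_inner[OF 1] \<kappa> by (intro power_mono) auto
        ultimately have "?Q \<le> r t * T t ^ n * u' t"
          using r0 \<kappa> m y(2)[OF t] T_inner[OF 1] by (intro mult_mono mult_nonneg_nonneg zero_le_power) auto
        then show ?thesis using 1 \<open>B \<ge> 0\<close> by simp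
      next
        case 2
        then have "0 \<le> r t * T t ^ n * u' t"
          using r_lower[of t] T_mid[of t] r0 deriv_pos[OF t] by (intro mult_nonneg_nonneg zero_le_power) auto
        then show ?thesis using 2(2) \<open>B \<ge> 0\<close> by (simp only: if_False)
      next
        case 3
        have "\<bar>r t * T t ^ n * u' t\<bar> = \<bar>r t * u' t\<bar> * \<bar>T t\<bar> ^ n" by (simp add: abs_mult power_abs)
        also have "\<dots> \<le> \<bar>r t * u' t\<bar> * 1"
          using T_outer[OF t] 3 by (intro mult_left_mono power_le_one) auto
        also have "\<dots> \<le> B" using B[OF t] by simp
        finally show ?thesis using 3(2) by (simp only: if_False)
      qed
    qed
    ultimately have "?Q * (b - a) \<le> 0 + B" by (rule has_integral_le)
    then show ?thesis by simp
  qed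
  define q where "q = r0 / 2 * u' y * (b - a)"
  have q: "q > 0" using r0 m ab by (simp add: q_def)
  obtain n where "B / q < (1 + \<kappa>) ^ n" using real_arch_pow[of "1 + \<kappa>" "B / q"] \<kappa> by auto
  then show False using bound[of n] q by (simp add: q_def field_simps)
qed

lemma eq_0_if_coef_eq_0:
  assumes "continuous_on {0..1} g" and "\<And>k. coef g k = 0" and "t \<in> {0..1}"
  shows "g t = 0"
  using continuous_constant_on_closure[of "{0<..<1}" g 0 t] eq_0_if_coef_eq_0_interior[OF assms(1,2)] assms
  by simp

end

section \<open>Termwise integration and elementary sums over the integers\<close>

lemma has_sum_integral:
  fixes a :: "int \<Rightarrow> real \<Rightarrow> complex" and M :: "int \<Rightarrow> real"
  assumes cont: "\<And>k. continuous_on {0..1} (a k)"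
    and bound: "\<And>k t. t \<in> {0..1} \<Longrightarrow> norm (a k t) \<le> M k" and M: "M summable_on UNIV"
  defines "h \<equiv> \<lambda>t. infsum (\<lambda>k. a k t) UNIV"
  shows "continuous_on {0..1} h"
    and "x \<in> {0..1} \<Longrightarrow> ((\<lambda>k. integral {0..x} (a k)) has_sum integral {0..x} h) UNIV"
proof -
  \<comment> \<open>By the Weierstrass test the finite sums converge uniformly along the filter of
    finite subsets; both claims pass from these sums to the limit.\<close>
  have U: "uniform_limit {0..1} (\<lambda>X t. \<Sum>k\<in>X. a k t) h (finite_subsets_at_top UNIV)"
    unfolding h_def by (rule Weierstrass_m_test_general) (use bound M in auto)
  show "continuous_on {0..1} h"
    by (rule uniform_limit_theorem[OF _ U]) (auto intro!: always_eventually continuous_intros cont)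
  show "((\<lambda>k. integral {0..x} (a k)) has_sum integral {0..x} h) UNIV" if x: "x \<in> {0..1}"
  proof -
    have U': "uniform_limit {0..x} (\<lambda>X t. \<Sum>k\<in>X. a k t) h (finite_subsets_at_top UNIV)"
      by (rule uniform_limit_on_subset[OF U]) (use x in auto)
    have cont': "continuous_on {0..x} (a k)" for k
      using x by (intro continuous_on_subset[OF cont]) auto
    have "continuous_on {0..x} (\<lambda>t. \<Sum>k\<in>X. a k t)" for X :: "int set"
      by (intro continuous_intros cont')
    then obtain I J where IJ: "\<And>X. ((\<lambda>t. \<Sum>k\<in>X. a k t) has_integral I X) {0..x}"
      "(h has_integral J) {0..x}" "(I \<longlongrightarrow> J) (finite_subsets_at_top UNIV)"
      using uniform_limit_integral[OF U'] by auto
    have "I X = (\<Sum>k\<in>X. integral {0..x} (a k))" for X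
    proof (cases "finite X")
      case True
      have "((\<lambda>t. \<Sum>k\<in>X. a k t) has_integral (\<Sum>k\<in>X. integral {0..x} (a k))) {0..x}"
        by (intro has_integral_sum True integrable_integral integrable_continuous_interval cont')
      then show ?thesis using IJ(1) has_integral_unique by blast
    next
      \<comment> \<open>For infinite \<open>X\<close> the sum is 0 by convention, so
        \<open>I X\<close> is the integral of 0 and the equality still holds.\<close>
      case False
      then show ?thesis using IJ(1)[of X] has_integral_unique[of _ _ _ 0] by auto
    qed
    then have "I = sum (\<lambda>k. integral {0..x} (a k))" by (rule ext)
    moreover have "integral {0..x} h = J" using IJ(2) by (rule integral_unique)
    ultimately show ?thesis using IJ(3) unfolding has_sum_def by simp
  qed
qed

text \<open>Each natural number is the absolute value of at most two integers.\<close>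

lemma sum_int_le_twice:
  fixes h :: "nat \<Rightarrow> real"
  assumes nonneg: "\<And>j. h j \<ge> 0" and K: "finite K" "\<And>k. k \<in> K \<Longrightarrow> n \<le> nat \<bar>k\<bar>"
    and B: "\<And>m. (\<Sum>j=n..m. h j) \<le> B"
  shows "(\<Sum>k\<in>K. h (nat \<bar>k\<bar>)) \<le> 2 * B"
proof -
  obtain m where m: "\<And>k. k \<in> K \<Longrightarrow> nat \<bar>k\<bar> \<le> m"
    using finite_nat_set_iff_bounded_le[of "(\<lambda>k. nat \<bar>k\<bar>) ` K"] K(1) by auto
  have sub: "K \<subseteq> int ` {n..m} \<union> (\<lambda>j. - int j) ` {n..m}"
  proof
    fix k assume "k \<in> K"
    then have "nat \<bar>k\<bar> \<in> {n..m}" using K(2) m by auto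
    then show "k \<in> int ` {n..m} \<union> (\<lambda>j. - int j) ` {n..m}"
      by (cases "k \<ge> 0") (auto intro!: image_eqI[of _ _ "nat \<bar>k\<bar>"])
  qed
  have "(\<Sum>k\<in>K. h (nat \<bar>k\<bar>)) \<le> (\<Sum>k\<in>int ` {n..m} \<union> (\<lambda>j. - int j) ` {n..m}. h (nat \<bar>k\<bar>))"
    by (intro sum_mono2 sub nonneg) auto
  also have "\<dots> \<le> (\<Sum>k\<in>int ` {n..m}. h (nat \<bar>k\<bar>)) + (\<Sum>k\<in>(\<lambda>j. - int j) ` {n..m}. h (nat \<bar>k\<bar>))"
    using sum.union_inter[of "int ` {n..m}" "(\<lambda>j. - int j) ` {n..m}" "\<lambda>k. h (nat \<bar>k\<bar>)"]
      sum_nonneg[of "int ` {n..m} \<inter> (\<lambda>j. - int j) ` {n..m}" "\<lambda>k. h (nat \<bar>k\<bar>)"] nonneg by simp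
  also have "\<dots> = (\<Sum>j=n..m. h j) + (\<Sum>j=n..m. h j)"
    by (simp add: sum.reindex inj_on_def)
  finally show ?thesis using B[of m] by simp
qed

text \<open>Telescoping gives 2 / n on one side of 0, and the two signs double it.\<close>

lemma sum_inverse_squares_le:
  assumes "finite (K :: int set)" "n \<ge> 1" "\<And>k. k \<in> K \<Longrightarrow> n \<le> nat \<bar>k\<bar>"
  shows "(\<Sum>k\<in>K. 1 / (of_int k)\<^sup>2) \<le> 4 / real n"
proof -
  \<comment> \<open>The subtracted 1 / m makes the induction telescope; at m = n the claim reads 1 /
    n^2 \<le> 1 / n.\<close>
  have *: "(\<Sum>j=n..m. 1 / (real j)\<^sup>2) \<le> 2 / real n - 1 / real m" if "m \<ge> n" for m
    using that
  proof (induction m rule: dec_induct)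
    case base
    have "1 / (real n)\<^sup>2 \<le> 1 / real n" using assms(2) by (simp add: field_simps power2_eq_square)
    then show ?case by simp
  next
    case (step m)
    have "1 / (real (Suc m))\<^sup>2 \<le> 1 / real m - 1 / real (Suc m)"
    proof -
      have "1 / (real (Suc m))\<^sup>2 \<le> 1 / (real m * real (Suc m))"
        using step assms(2) by (intro divide_left_mono) (auto simp: power2_eq_square)
      also have "\<dots> = 1 / real m - 1 / real (Suc m)"
        using step assms(2) by (simp add: field_simps)
      finally show ?thesis .
    qed
    then show ?case using step by (simp add: sum.nat_ivl_Suc')
  qed
  have "(\<Sum>j=n..m. 1 / (real j)\<^sup>2) \<le> 2 / real n" for m
    using *[of m] by (cases "m \<ge> n") (auto intro: order_trans)
  from sum_int_le_twice[of "\<lambda>j. 1 / (real j)\<^sup>2", OF _ assms(1,3) this]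
  show ?thesis by simp
qed

section \<open>Inversion, differentiability and tail estimates\<close>

context phase_coordinate
begin

lemma deriv_bounded: "\<exists>B. \<forall>t\<in>{0..1}. u' t \<le> B"
  using continuous_attains_sup[of "{0..1}" u'] deriv_cont by auto

text \<open>The sum \<open>h\<close> of the series is continuous and, by termwise integration, has
  the same coefficients as \<open>g\<close>; uniqueness then gives equality.\<close>

lemma inversion:
  assumes g: "continuous_on {0..1} g" and summable: "(\<lambda>k. norm (coef g k)) summable_on UNIV"
    and t: "t \<in> {0..1}"
  shows "((\<lambda>k. coef g k * mode k t) has_sum g t) UNIV"
proof -
  define h where "h t = infsum (\<lambda>k. coef g k * mode k t) UNIV" for t
  have summable_at: "(\<lambda>k. coef g k * mode k s) summable_on UNIV" for s
    by (rule abs_summable_summable) (simp add: norm_mult summable)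
  have h: "continuous_on {0..1} h"
    unfolding h_def by (rule has_sum_integral(1)[OF _ _ summable]) (auto intro!: continuous_intros simp: norm_mult)
  obtain B where B: "\<And>t. t \<in> {0..1} \<Longrightarrow> u' t \<le> B"
    using deriv_bounded by blast
  have coef_h: "coef h j = coef g j" for j
  proof -
    let ?a = "\<lambda>k t. coef g k * mode k t * mode (- j) t * of_real (u' t)"
    have "((\<lambda>k. integral {0..1} (?a k)) has_sum integral {0..1} (\<lambda>t. infsum (\<lambda>k. ?a k t) UNIV)) UNIV"
    proof (rule has_sum_integral(2))
      show "norm (?a k t) \<le> norm (coef g k) * B" if "t \<in> {0..1}" for k t
        using B[OF that] deriv_pos[OF that] by (auto simp: norm_mult intro!: mult_left_mono)
      show "(\<lambda>k. norm (coef g k) * B) summable_on UNIV"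
        using summable by (rule summable_on_cmult_left)
    qed (auto intro!: continuous_intros)
    moreover have "infsum (\<lambda>k. ?a k t) UNIV = h t * mode (- j) t * of_real (u' t)" for t
      unfolding h_def mult.assoc[of _ "mode (- j) t"] using summable_at by (intro infsum_cmult_left)
    moreover have "integral {0..1} (?a k) = (if k = j then coef g j else 0)" for k
    proof -
      have "((\<lambda>t. coef g k * (mode k t * mode (- j) t * of_real (u' t))) has_integral coef g k * coef (mode k) j) {0..1}"
        by (intro has_integral_mult_right coef_integrable mode_cont)
      then have "integral {0..1} (\<lambda>t. coef g k * (mode k t * mode (- j) t * of_real (u' t))) = coef g k * coef (mode k) j"
        by (rule integral_unique)
      then show ?thesis by (simp add: coef_mode mult.assoc del: integral_mult_right split: if_splits)
    qed
    ultimately have "((\<lambda>k. if k = j then coef g j else 0) has_sum coef h j) UNIV"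
      by (simp add: coef_def)
    moreover have "((\<lambda>k. if k = j then coef g j else 0) has_sum coef g j) UNIV"
      by (rule has_sum_finite_neutralI[of "{j}"]) auto
    ultimately show ?thesis using has_sum_unique by blast
  qed
  have "coef (\<lambda>t. g t - h t) j = 0" for j
  proof -
    have "((\<lambda>t. g t * mode (- j) t * of_real (u' t) - h t * mode (- j) t * of_real (u' t))
        has_integral coef g j - coef h j) {0..1}"
      by (intro has_integral_diff coef_integrable g h)
    then show ?thesis unfolding coef_def[of "\<lambda>t. g t - h t"] coef_h
      by (intro integral_unique) (simp add: algebra_simps)
  qed
  then have "g t - h t = 0"
    by (intro eq_0_if_coef_eq_0[of "\<lambda>t. g t - h t"] continuous_intros g h t)
  then show ?thesis using has_sum_infsum[OF summable_at[of t]] by (simp add: h_def)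
qed

text \<open>The differentiated series converges uniformly and its termwise integral is
  \<open>g - g 0\<close>, so \<open>g\<close> is an antiderivative of a continuous function. The
  bound keeps the factor \<open>u'\<close> so that it can be compared with the density of another
  coordinate.\<close>

lemma C1_if_summable:
  assumes g: "continuous_on {0..1} g" and summable: "(\<lambda>k. \<bar>of_int k\<bar> * norm (coef g k)) summable_on UNIV"
  obtains g' where "\<And>t. t \<in> {0..1} \<Longrightarrow> (g has_vector_derivative g' t) (at t within {0..1})"
    "continuous_on {0..1} g'"
    "\<And>t. t \<in> {0..1} \<Longrightarrow> norm (g' t) \<le> 2 * pi * (\<Sum>\<^sub>\<infinity>k. \<bar>of_int k\<bar> * norm (coef g k)) * u' t"
    "g 0 = g 1"
proof -
  \<comment> \<open>The weight vanishes at k = 0, so that coefficient is put back by hand before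
    comparing.\<close>
  have "(\<lambda>k. \<bar>of_int k\<bar> * norm (coef g k) + (if k = 0 then norm (coef g 0) else 0)) summable_on UNIV"
    by (intro summable_on_add summable finite_nonzero_values_imp_summable_on) auto
  then have summable0: "(\<lambda>k. norm (coef g k)) summable_on UNIV"
  proof (rule summable_on_comparison_test)
    show "norm (coef g k) \<le> \<bar>of_int k\<bar> * norm (coef g k) + (if k = 0 then norm (coef g 0) else 0)" for k
    proof (cases "k = 0")
      case False
      then have "1 * norm (coef g k) \<le> \<bar>of_int k\<bar> * norm (coef g k)" by (intro mult_right_mono) auto
      then show ?thesis using False by simp
    qed simp
  qed auto
  note inv = inversion[OF g summable0]
  define a where "a k t = coef g k * (2 * pi * \<i> * of_int k * mode k t * of_real (u' t))" for k t
  define g' where "g' t = infsum (\<lambda>k. a k t) UNIV" for t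
  obtain B where B: "\<And>t. t \<in> {0..1} \<Longrightarrow> u' t \<le> B"
    using deriv_bounded by blast
  have norm_a: "norm (a k t) = 2 * pi * (\<bar>of_int k\<bar> * norm (coef g k)) * u' t" if "t \<in> {0..1}" for k t
    using deriv_pos[OF that] by (simp add: a_def norm_mult)
  have a_bound: "norm (a k t) \<le> 2 * pi * (\<bar>of_int k\<bar> * norm (coef g k)) * B" if "t \<in> {0..1}" for k t
    unfolding norm_a[OF that] using B[OF that] by (intro mult_left_mono) auto
  have a_cont: "continuous_on {0..1} (a k)" for k
    unfolding a_def by (intro continuous_intros)
  have M: "(\<lambda>k. 2 * pi * (\<bar>of_int k\<bar> * norm (coef g k)) * B) summable_on UNIV"
    by (intro summable_on_cmult_left summable_on_cmult_right summable)
  have g'_cont: "continuous_on {0..1} g'"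
    unfolding g'_def by (rule has_sum_integral(1)[OF a_cont a_bound M])
  have int_g': "integral {0..x} g' = g x - g 0" if x: "x \<in> {0..1}" for x
  proof -
    have "integral {0..x} (a k) = coef g k * mode k x - coef g k * mode k 0" for k
    proof (intro integral_unique fundamental_theorem_of_calculus)
      fix t assume t: "t \<in> {0..x}"
      then have "((\<lambda>t. coef g k * mode k t) has_vector_derivative a k t) (at t within {0..1})"
        unfolding a_def using x by (intro has_vector_derivative_mult_right mode_deriv) auto
      then show "((\<lambda>t. coef g k * mode k t) has_vector_derivative a k t) (at t within {0..x})"
        by (rule has_vector_derivative_within_subset) (use x in auto)
    qed (use x in auto)
    moreover have "((\<lambda>k. integral {0..x} (a k)) has_sum integral {0..x} g') UNIV"
      unfolding g'_def by (rule has_sum_integral(2)[OF a_cont a_bound M x])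
    moreover have "((\<lambda>k. coef g k * mode k x - coef g k * mode k 0) has_sum g x - g 0) UNIV"
      using has_sum_add[OF inv[OF x] has_sum_uminusI[OF inv[of 0]]] by simp
    ultimately show ?thesis using has_sum_unique by fastforce
  qed
  show thesis
  proof
    show "continuous_on {0..1} g'" by fact
    show "g 0 = g 1" using has_sum_unique[OF inv[of 0]] inv[of 1] by simp
    show "(g has_vector_derivative g' t) (at t within {0..1})" if t: "t \<in> {0..1}" for t
    proof -
      have "((\<lambda>x. g 0 + integral {0..x} g') has_vector_derivative 0 + g' t) (at t within {0..1})"
        by (intro has_vector_derivative_add has_vector_derivative_const integral_has_vector_derivative[OF g'_cont t])
      then have "((\<lambda>x. g 0 + integral {0..x} g') has_vector_derivative g' t) (at t within {0..1})"
        by simp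
      then show ?thesis
        by (rule has_vector_derivative_transform[OF t, rotated]) (use int_g' in auto)
    qed
    show "norm (g' t) \<le> 2 * pi * (\<Sum>\<^sub>\<infinity>k. \<bar>of_int k\<bar> * norm (coef g k)) * u' t" if t: "t \<in> {0..1}" for t
    proof -
      have "(\<lambda>k. norm (a k t)) summable_on UNIV"
        unfolding norm_a[OF t] by (intro summable_on_cmult_left summable_on_cmult_right summable)
      then have "norm (g' t) \<le> (\<Sum>\<^sub>\<infinity>k. norm (a k t))"
        unfolding g'_def by (rule norm_infsum_bound)
      also have "\<dots> = 2 * pi * (\<Sum>\<^sub>\<infinity>k. \<bar>of_int k\<bar> * norm (coef g k)) * u' t"
        unfolding norm_a[OF t] by (simp only: infsum_cmult_left' infsum_cmult_right')
      finally show ?thesis .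
    qed
  qed
qed

text \<open>The boundary terms cancel because \<open>g\<close> and the modes agree at 0 and 1. The
  quotient by \<open>u'\<close> is the derivative with respect to the coordinate
  \<open>u\<close>.\<close>

lemma coef_by_parts:
  assumes g: "\<And>t. t \<in> {0..1} \<Longrightarrow> (g has_vector_derivative g' t) (at t within {0..1})"
    and g': "continuous_on {0..1} g'" and "g 0 = g 1" and "k \<noteq> 0"
  shows "coef g k = coef (\<lambda>t. g' t / of_real (u' t)) k / (2 * pi * \<i> * of_int k)"
proof -
  have g_cont: "continuous_on {0..1} g"
    using g by (rule continuous_on_vector_derivative)
  have "((\<lambda>t. g t * mode (- k) t) has_vector_derivative
      g t * (2 * pi * \<i> * of_int (- k) * mode (- k) t * of_real (u' t)) + g' t * mode (- k) t) (at t within {0..1})"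
    if "t \<in> {0..1}" for t
    by (intro has_vector_derivative_mult g mode_deriv that)
  then have "((\<lambda>t. g t * (2 * pi * \<i> * of_int (- k) * mode (- k) t * of_real (u' t)) + g' t * mode (- k) t)
      has_integral g 1 * mode (- k) 1 - g 0 * mode (- k) 0) {0..1}"
    by (intro fundamental_theorem_of_calculus) auto
  then have 1: "((\<lambda>t. g t * (2 * pi * \<i> * of_int (- k) * mode (- k) t * of_real (u' t)) + g' t * mode (- k) t)
      has_integral 0) {0..1}"
    using \<open>g 0 = g 1\<close> by simp
  have 2: "((\<lambda>t. (2 * pi * \<i> * of_int k) * (g t * mode (- k) t * of_real (u' t))) has_integral
      (2 * pi * \<i> * of_int k) * coef g k) {0..1}"
    by (intro has_integral_mult_right coef_integrable g_cont)
  from has_integral_add[OF 1 2]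
  have "((\<lambda>t. g' t * mode (- k) t) has_integral (2 * pi * \<i> * of_int k) * coef g k) {0..1}"
    by (simp add: algebra_simps)
  then have "((\<lambda>t. g' t / of_real (u' t) * mode (- k) t * of_real (u' t)) has_integral
      (2 * pi * \<i> * of_int k) * coef g k) {0..1}"
    by (rule has_integral_eq[rotated]) (use deriv_pos in \<open>force\<close>)
  then show ?thesis
    unfolding coef_def[of "\<lambda>t. g' t / of_real (u' t)"] using \<open>k \<noteq> 0\<close> by (simp add: integral_unique)
qed

text \<open>Integration by parts gains a factor 1 / |k|, which Cauchy-Schwarz pairs with the
  coefficients of dg/du; Bessel's inequality controls their squares by D^2. The constant involves
  only \<open>D\<close>, so it is the same in every coordinate.\<close>

lemma coef_tail_le:
  assumes g: "\<And>t. t \<in> {0..1} \<Longrightarrow> (g has_vector_derivative g' t) (at t within {0..1})"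
    and g': "continuous_on {0..1} g'" and per: "g 0 = g 1"
    and D: "\<And>t. t \<in> {0..1} \<Longrightarrow> norm (g' t) \<le> D * u' t"
    and K: "finite K" "n \<ge> 1" "\<And>k. k \<in> K \<Longrightarrow> n \<le> nat \<bar>k\<bar>"
  shows "(\<Sum>k\<in>K. norm (coef g k)) \<le> D / sqrt n"
proof -
  define q where "q t = g' t / of_real (u' t)" for t
  have q_cont: "continuous_on {0..1} q"
    unfolding q_def using deriv_pos by (intro continuous_intros g') force
  have q_le: "norm (q t) \<le> D" if "t \<in> {0..1}" for t
    using D[OF that] deriv_pos[OF that] by (simp add: q_def norm_divide field_simps)
  have "D \<ge> 0" using q_le[of 0] norm_ge_zero[of "q 0"] by (auto simp del: norm_ge_zero)
  have "((\<lambda>t. D\<^sup>2 * u' t) has_integral D\<^sup>2 * (u 1 - u 0)) {0..1}"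
    using deriv by (intro has_integral_mult_right fundamental_theorem_of_calculus)
      (auto simp: has_real_derivative_iff_has_vector_derivative)
  then have "integral {0..1} (\<lambda>t. (cmod (q t))\<^sup>2 * u' t) \<le> D\<^sup>2"
    using q_le deriv_pos
    by (intro has_integral_le[OF integrable_integral[OF integrable_continuous_interval]])
       (auto simp: at_0 at_1 less_imp_le intro!: continuous_intros q_cont mult_right_mono power_mono)
  then have bessel_q: "(\<Sum>k\<in>K. (cmod (coef q k))\<^sup>2) \<le> D\<^sup>2"
    using bessel[OF q_cont K(1)] by simp
  have coef_g: "norm (coef g k) = norm (coef q k) * (1 / (2 * pi * \<bar>of_int k\<bar>))" if "k \<in> K" for k
  proof -
    have "k \<noteq> 0" using K(2) K(3)[OF that] by auto
    from coef_by_parts[OF g g' per this] show ?thesis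
      by (simp add: q_def[abs_def] norm_divide norm_mult)
  qed
  have "(\<Sum>k\<in>K. (1 / (2 * pi * \<bar>of_int k\<bar>))\<^sup>2) = (1 / (2 * pi)\<^sup>2) * (\<Sum>k\<in>K. 1 / (of_int k)\<^sup>2)"
    by (simp add: sum_distrib_left power_divide power_mult_distrib)
  also have "\<dots> \<le> (1 / (2 * pi)\<^sup>2) * (4 / real n)"
    by (intro mult_left_mono sum_inverse_squares_le K) auto
  \<comment> \<open>As 2 pi is at least 2, its square absorbs the 4 from the sum of inverse
    squares.\<close>
  also have "\<dots> \<le> 1 / real n"
  proof -
    have "2\<^sup>2 \<le> (2 * pi)\<^sup>2" using pi_ge_two by (intro power_mono) auto
    then show ?thesis using K(2) by (simp add: field_simps)
  qed
  finally have inv: "(\<Sum>k\<in>K. (1 / (2 * pi * \<bar>of_int k\<bar>))\<^sup>2) \<le> 1 / real n" .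
  have "(\<Sum>k\<in>K. norm (coef g k))\<^sup>2 = (\<Sum>k\<in>K. norm (coef q k) * (1 / (2 * pi * \<bar>of_int k\<bar>)))\<^sup>2"
    using coef_g by simp
  also have "\<dots> \<le> (\<Sum>k\<in>K. (cmod (coef q k))\<^sup>2) * (\<Sum>k\<in>K. (1 / (2 * pi * \<bar>of_int k\<bar>))\<^sup>2)"
    by (rule Cauchy_Schwarz_ineq_sum)
  also have "\<dots> \<le> D\<^sup>2 * (1 / real n)"
    by (intro mult_mono bessel_q inv sum_nonneg) auto
  also have "\<dots> = (D / sqrt n)\<^sup>2" by (simp add: power_divide)
  finally show ?thesis by (rule power2_le_imp_le) (use \<open>D \<ge> 0\<close> in auto)
qed

end

section \<open>Demodulation\<close>

context phase_coordinate
begin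

lemma coef_cnj: "coef (\<lambda>t. cnj (g t)) k = cnj (coef g (- k))"
  by (simp add: coef_def integral_cnj cnj_mode)

lemma coef_mult_mode: "coef (\<lambda>t. g t * mode j t) k = coef g (k - j)"
  unfolding coef_def by (simp add: mult.assoc mode_mult)

lemma coef_abs_summable:
  assumes g: "\<And>t. t \<in> {0..1} \<Longrightarrow> (g has_vector_derivative g' t) (at t within {0..1})"
    and g': "continuous_on {0..1} g'" and per: "g 0 = g 1"
    and D: "\<And>t. t \<in> {0..1} \<Longrightarrow> norm (g' t) \<le> D * u' t"
  shows "(\<lambda>k. norm (coef g k)) summable_on UNIV"
proof (rule nonneg_bdd_above_summable_on)
  have "sum (\<lambda>k. norm (coef g k)) K \<le> norm (coef g 0) + D" if K: "finite K" for K
  proof -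
    have "sum (\<lambda>k. norm (coef g k)) K \<le> (\<Sum>k\<in>insert 0 (K - {0}). norm (coef g k))"
      using K by (intro sum_mono2) auto
    also have "\<dots> = norm (coef g 0) + (\<Sum>k\<in>K - {0}. norm (coef g k))"
      using K by (subst sum.insert) auto
    also have "(\<Sum>k\<in>K - {0}. norm (coef g k)) \<le> D / sqrt 1"
      using coef_tail_le[OF g g' per D, of "K - {0}" 1] K by fastforce
    finally show ?thesis by simp
  qed
  then show "bdd_above (sum (\<lambda>k. norm (coef g k)) ` {K. K \<subseteq> UNIV \<and> finite K})"
    by (intro bdd_aboveI2) auto
qed auto

text \<open>This is a + i b: frequencies near N are moved to 0 and cut to |k| < N / 2. The factor 2
  is there because the cosine carries the envelope in two halves, at N and at -N.\<close>

definition demod :: "(real \<Rightarrow> real) \<Rightarrow> nat \<Rightarrow> real \<Rightarrow> complex" where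
  "demod f N t = 2 * (\<Sum>k | 2 * \<bar>k\<bar> < int N. coef (\<lambda>s. of_real (f s)) (k + int N) * mode k t)"

lemma finite_band: "finite {k :: int. 2 * \<bar>k\<bar> < int N}"
  by (rule finite_subset[of _ "{- int N..int N}"]) auto

text \<open>Within the band, the shifted signal contains \<open>g\<close>, the modes of
  \<open>f0\<close> near N, and the conjugate of \<open>g\<close> moved to -2 N; beyond the band the
  modes of \<open>g\<close> are lost. Each of the three errors involves only coefficients at
  frequencies of modulus at least N / 2, hence is a tail.\<close>

lemma norm_demod_diff_le:
  fixes f f0 :: "real \<Rightarrow> real"
  assumes f: "\<And>t. t \<in> {0..1} \<Longrightarrow> f t = f0 t + Re (g t * mode (int N) t)" and N: "N > 0"
    and f0: "\<And>t. t \<in> {0..1} \<Longrightarrow> (f0 has_vector_derivative f0' t) (at t within {0..1})"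
      "continuous_on {0..1} f0'" "f0 0 = f0 1" "\<And>t. t \<in> {0..1} \<Longrightarrow> \<bar>f0' t\<bar> \<le> D * u' t"
    and g: "\<And>t. t \<in> {0..1} \<Longrightarrow> (g has_vector_derivative g' t) (at t within {0..1})"
      "continuous_on {0..1} g'" "g 0 = g 1" "\<And>t. t \<in> {0..1} \<Longrightarrow> norm (g' t) \<le> D * u' t"
    and t: "t \<in> {0..1}"
  shows "norm (demod f N t - g t) \<le> 8 * D / sqrt N"
proof -
  let ?W = "{k :: int. 2 * \<bar>k\<bar> < int N}"
  define F0 where "F0 s = complex_of_real (f0 s)" for s
  \<comment> \<open>Half of \<open>N\<close> rounded up is the least modulus of an integer frequency
    outside the band, for odd \<open>N\<close> too.\<close>
  define n where "n = (N + 1) div 2"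
  have n: "n \<ge> 1" "2 * n \<ge> N" using N by (auto simp: n_def)
  have F0: "\<And>t. t \<in> {0..1} \<Longrightarrow> (F0 has_vector_derivative of_real (f0' t)) (at t within {0..1})"
    "continuous_on {0..1} (\<lambda>t. complex_of_real (f0' t))" "F0 0 = F0 1"
    "\<And>t. t \<in> {0..1} \<Longrightarrow> norm (complex_of_real (f0' t)) \<le> D * u' t"
    using f0 unfolding F0_def by (auto intro!: has_vector_derivative_of_real continuous_intros simp: has_real_derivative_iff_has_vector_derivative)
  have F0_cont: "continuous_on {0..1} F0" using F0(1) by (rule continuous_on_vector_derivative)
  have g_cont: "continuous_on {0..1} g" using g(1) by (rule continuous_on_vector_derivative)
  have coef_f: "coef (\<lambda>s. of_real (f s)) k
      = coef F0 k + coef g (k - int N) / 2 + cnj (coef g (- k - int N)) / 2" for k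
  proof -
    let ?g1 = "\<lambda>t. g t * mode (int N) t"
    let ?g2 = "\<lambda>t. cnj (g t) * mode (- int N) t"
    have "((\<lambda>t. F0 t * mode (- k) t * of_real (u' t) + ?g1 t * mode (- k) t * of_real (u' t) / 2
        + ?g2 t * mode (- k) t * of_real (u' t) / 2) has_integral
        coef F0 k + coef ?g1 k / 2 + coef ?g2 k / 2) {0..1}"
      by (intro has_integral_add has_integral_divide coef_integrable F0_cont continuous_intros g_cont)
    moreover have "F0 t * mode (- k) t * of_real (u' t) + ?g1 t * mode (- k) t * of_real (u' t) / 2
        + ?g2 t * mode (- k) t * of_real (u' t) / 2 = of_real (f t) * mode (- k) t * of_real (u' t)"
      if "t \<in> {0..1}" for t
    proof -
      have "of_real (f t) = F0 t + (?g1 t + cnj (?g1 t)) / 2"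
        unfolding f[OF that] F0_def complex_add_cnj by simp
      also have "cnj (?g1 t) = ?g2 t" by (simp add: cnj_mode)
      finally show ?thesis by (simp add: algebra_simps add_divide_distrib)
    qed
    ultimately have "((\<lambda>t. of_real (f t) * mode (- k) t * of_real (u' t)) has_integral
        coef F0 k + coef ?g1 k / 2 + coef ?g2 k / 2) {0..1}"
      by (rule has_integral_eq[rotated])
    then show ?thesis
      unfolding coef_def[of "\<lambda>s. of_real (f s)"] coef_mult_mode coef_cnj
      by (simp add: integral_unique algebra_simps)
  qed
  have g_sum: "((\<lambda>k. coef g k * mode k t) has_sum g t) UNIV"
    by (rule inversion[OF g_cont coef_abs_summable[OF g] t])
  define R where "R = infsum (\<lambda>k. coef g k * mode k t) (- ?W)"
  have summable_out: "(\<lambda>k. norm (coef g k)) summable_on - ?W"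
    using coef_abs_summable[OF g] by (rule summable_on_subset) auto
  have "((\<lambda>k. coef g k * mode k t) has_sum R) (- ?W)"
    unfolding R_def
    by (rule has_sum_infsum[OF abs_summable_summable]) (simp add: norm_mult summable_out)
  moreover have "((\<lambda>k. coef g k * mode k t) has_sum (\<Sum>k\<in>?W. coef g k * mode k t)) ?W"
    using finite_band by (rule has_sum_finite)
  ultimately have "((\<lambda>k. coef g k * mode k t) has_sum R + (\<Sum>k\<in>?W. coef g k * mode k t)) (- ?W \<union> ?W)"
    by (rule has_sum_Un_disjoint) auto
  then have g_split: "g t = R + (\<Sum>k\<in>?W. coef g k * mode k t)"
    using has_sum_unique[OF g_sum] by (simp add: Un_commute)
  have "norm R \<le> (\<Sum>\<^sub>\<infinity>k\<in>- ?W. norm (coef g k * mode k t))"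
    unfolding R_def by (rule norm_infsum_bound) (simp add: norm_mult summable_out)
  also have "\<dots> = (\<Sum>\<^sub>\<infinity>k\<in>- ?W. norm (coef g k))" by (simp add: norm_mult)
  also have "\<dots> \<le> D / sqrt n"
  proof (rule infsum_le_finite_sums[OF summable_out])
    fix K assume "finite K" "K \<subseteq> - ?W"
    then show "(\<Sum>k\<in>K. norm (coef g k)) \<le> D / sqrt n"
      by (intro coef_tail_le[OF g] n) (auto simp: n_def)
  qed
  finally have R: "norm R \<le> D / sqrt n" .
  \<comment> \<open>The unwanted frequencies k + N and - k - 2 N are distinct for distinct k and
    have modulus at least \<open>n\<close>, so reindexing turns both sums into tails.\<close>
  have inj: "inj_on (\<lambda>k. k + int N) ?W" "inj_on (\<lambda>k. - k - 2 * int N) ?W" by (auto simp: inj_on_def)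
  have S1: "(\<Sum>k\<in>?W. norm (coef F0 (k + int N))) \<le> D / sqrt n"
  proof -
    have "(\<Sum>k\<in>?W. norm (coef F0 (k + int N))) = (\<Sum>k\<in>(\<lambda>k. k + int N) ` ?W. norm (coef F0 k))"
      by (subst sum.reindex[OF inj(1)]) simp
    also have "\<dots> \<le> D / sqrt n"
      by (intro coef_tail_le[OF F0] n) (auto simp: n_def finite_band)
    finally show ?thesis .
  qed
  have S2: "(\<Sum>k\<in>?W. norm (coef g (- k - 2 * int N))) \<le> D / sqrt n"
  proof -
    have "(\<Sum>k\<in>?W. norm (coef g (- k - 2 * int N))) = (\<Sum>k\<in>(\<lambda>k. - k - 2 * int N) ` ?W. norm (coef g k))"
      by (subst sum.reindex[OF inj(2)]) simp
    also have "\<dots> \<le> D / sqrt n"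
      by (intro coef_tail_le[OF g] n) (auto simp: n_def finite_band)
    finally show ?thesis .
  qed
  have "demod f N t = (\<Sum>k\<in>?W. (2 * coef F0 (k + int N) + coef g k + cnj (coef g (- k - 2 * int N))) * mode k t)"
    unfolding demod_def coef_f sum_distrib_left by (intro sum.cong refl) (simp add: field_simps)
  then have "demod f N t - g t
      = (\<Sum>k\<in>?W. (2 * coef F0 (k + int N) + cnj (coef g (- k - 2 * int N))) * mode k t) - R"
    unfolding g_split by (simp add: sum.distrib[symmetric] sum_subtractf[symmetric] algebra_simps)
  then have "norm (demod f N t - g t)
      \<le> norm (\<Sum>k\<in>?W. (2 * coef F0 (k + int N) + cnj (coef g (- k - 2 * int N))) * mode k t) + norm R"
    by (simp add: norm_triangle_ineq4)
  also have "\<dots> \<le> (\<Sum>k\<in>?W. 2 * norm (coef F0 (k + int N)) + norm (coef g (- k - 2 * int N))) + D / sqrt n"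
  proof (intro add_mono R order_trans[OF norm_sum] sum_mono)
    fix k
    have "norm (2 * coef F0 (k + int N) + cnj (coef g (- k - 2 * int N)))
        \<le> norm (2 * coef F0 (k + int N)) + norm (cnj (coef g (- k - 2 * int N)))"
      by (rule norm_triangle_ineq)
    then show "norm ((2 * coef F0 (k + int N) + cnj (coef g (- k - 2 * int N))) * mode k t)
        \<le> 2 * norm (coef F0 (k + int N)) + norm (coef g (- k - 2 * int N))"
      by (simp add: norm_mult)
  qed
  \<comment> \<open>Two tails for \<open>F0\<close>, one for the conjugate of \<open>g\<close> and
    one for the remainder \<open>R\<close>.\<close>
  also have "\<dots> \<le> 4 * (D / sqrt n)"
    using S1 S2 by (simp add: sum.distrib sum_distrib_left[symmetric])
  also have "\<dots> \<le> 8 * D / sqrt N"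
  proof -
    have "norm (g' 0) \<le> D * u' 0" using g(4) by simp
    then have "D \<ge> 0" using deriv_pos[of 0] norm_ge_zero[of "g' 0"]
      by (smt (verit) atLeastAtMost_iff zero_le_mult_iff)
    have "sqrt N \<le> sqrt (4 * n)" using n by simp
    then have "sqrt N \<le> 2 * sqrt n" by (simp add: real_sqrt_mult)
    then have "1 / sqrt n \<le> 2 / sqrt N" using N n by (simp add: field_simps)
    then show ?thesis using mult_left_mono[of "1 / sqrt n" "2 / sqrt N" "4 * D"] \<open>D \<ge> 0\<close> by simp
  qed
  finally show ?thesis .
qed

text \<open>Opposite coefficients of a real function are conjugate and the band is symmetric. This
  makes the two shifted halves in the formulas for a and b conjugate to each other.\<close>

lemma cnj_demod_sum:
  "cnj (\<Sum>k | 2 * \<bar>k\<bar> < int N. coef (\<lambda>s. of_real (f s)) (k + int N) * mode k t)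
   = (\<Sum>k | 2 * \<bar>k\<bar> < int N. coef (\<lambda>s. of_real (f s)) (k - int N) * mode k t)"
proof -
  have *: "cnj (coef (\<lambda>s. of_real (f s)) k) = coef (\<lambda>s. of_real (f s)) (- k)" for k
    using coef_cnj[of "\<lambda>s. of_real (f s)" "- k"] by simp
  show ?thesis
    unfolding cnj_sum complex_cnj_mult cnj_mode *
    by (rule sum.reindex_bij_witness[of _ uminus uminus]) (auto simp: algebra_simps)
qed

end

section \<open>Regularity and zeros of the demodulated signal\<close>

context phase_coordinate
begin

lemma demod_C1:
  obtains z' where "\<And>t. t \<in> {0..1} \<Longrightarrow> (demod f N has_vector_derivative z' t) (at t within {0..1})"
    "continuous_on {0..1} z'" "demod f N 0 = demod f N 1"
proof
  let ?z' = "\<lambda>t. 2 * (\<Sum>k | 2 * \<bar>k\<bar> < int N. coef (\<lambda>s. of_real (f s)) (k + int N) *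
    (2 * pi * \<i> * of_int k * mode k t * of_real (u' t)))"
  show "(demod f N has_vector_derivative ?z' t) (at t within {0..1})" if "t \<in> {0..1}" for t
    unfolding demod_def[abs_def]
    by (intro has_vector_derivative_mult_right has_vector_derivative_sum mode_deriv that)
  show "continuous_on {0..1} ?z'" by (intro continuous_intros)
  show "demod f N 0 = demod f N 1" by (simp add: demod_def)
qed

lemma inj_on_mode_1: "inj_on (mode 1) {0..<1}"
proof (rule inj_onI)
  fix s t assume st: "s \<in> {0..<1}" "t \<in> {0..<1}" "mode 1 s = mode 1 t"
  then have "sin (2 * pi * u s) = sin (2 * pi * u t) \<and> cos (2 * pi * u s) = cos (2 * pi * u t)"
    by (simp add: mode_def complex_eq_iff)
  then obtain n :: int where "2 * pi * u s = 2 * pi * u t + 2 * pi * n"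
    unfolding sin_cos_eq_iff by blast
  then have "2 * pi * u s = 2 * pi * (u t + n)" by (simp add: distrib_left)
  then have n: "u s = u t + n" by simp
  have "0 \<le> u s" "u s < 1" "0 \<le> u t" "u t < 1"
    using st u_range[of s] u_range[of t] u_less_iff[of s 1] u_less_iff[of t 1] by (auto simp: at_1)
  then have "\<bar>real_of_int n\<bar> < 1" using n by linarith
  then have "u s = u t" using n by simp
  then show "s = t" using st u_le_iff[of s t] u_le_iff[of t s] by auto
qed

text \<open>
  Up to the unimodular factor \<open>mode N t\<close>, the real part is a polynomial in \<open>mode 1 t\<close>.
\<close>

lemma demod_Re_zeros:
  "(\<forall>t. Re (demod f N t) = 0) \<or> finite {t \<in> {0..1}. Re (demod f N t) = 0}"
proof -
  define c where "c = coef (\<lambda>s. of_real (f s))"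
  \<comment> \<open>Multiplication by mode N moves the band to exponents between 0 and 2 N;
    exponents outside it get coefficient 0.\<close>
  define d where "d i = (if 2 * \<bar>int i - int N\<bar> < int N then c (int i) + c (int i - 2 * int N) else 0)" for i
  have mode_power: "mode 1 t ^ i = mode (int i) t" for i t
    unfolding mode_def Complex.DeMoivre by (rule arg_cong[of _ _ cis]) simp
  have poly: "of_real (2 * Re (demod f N t)) * mode (int N) t = 2 * (\<Sum>i\<le>2 * N. d i * mode 1 t ^ i)" for t
  proof -
    have "of_real (2 * Re (demod f N t)) = demod f N t + cnj (demod f N t)"
      by (simp add: complex_add_cnj)
    also have "\<dots> = 2 * (\<Sum>k | 2 * \<bar>k\<bar> < int N. (c (k + int N) + c (k - int N)) * mode k t)"
      by (simp only: demod_def complex_cnj_mult complex_cnj_numeral cnj_demod_sum c_def distrib_left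
        distrib_right sum.distrib)
    finally have "of_real (2 * Re (demod f N t)) * mode (int N) t
        = 2 * (\<Sum>k | 2 * \<bar>k\<bar> < int N. (c (k + int N) + c (k - int N)) * mode (k + int N) t)"
      by (simp add: sum_distrib_right mult.assoc mode_mult)
    also have "(\<Sum>k | 2 * \<bar>k\<bar> < int N. (c (k + int N) + c (k - int N)) * mode (k + int N) t)
        = (\<Sum>i\<in>{i. i \<le> 2 * N \<and> 2 * \<bar>int i - int N\<bar> < int N}. d i * mode (int i) t)"
      by (rule sum.reindex_bij_witness[of _ "\<lambda>i. int i - int N" "\<lambda>k. nat (k + int N)"]) (auto simp: d_def)
    also have "\<dots> = (\<Sum>i\<le>2 * N. d i * mode (int i) t)"
      by (rule sum.mono_neutral_left) (auto simp: d_def)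
    finally show ?thesis by (simp add: mode_power)
  qed
  have zero_iff: "Re (demod f N t) = 0 \<longleftrightarrow> (\<Sum>i\<le>2 * N. d i * mode 1 t ^ i) = 0" for t
  proof -
    have "mode (int N) t \<noteq> 0" using norm_mode[of "int N" t] by (auto simp del: norm_mode)
    then show ?thesis using poly[of t] by auto
  qed
  show ?thesis
  proof (cases "\<forall>i\<le>2 * N. d i = 0")
    case True
    then show ?thesis using zero_iff by simp
  next
    case False
    \<comment> \<open>A nonzero polynomial has finitely many roots, and \<open>mode 1\<close> takes
      each at most once on [0,1). The endpoint 1, where the mode agrees with that at 0, is added
      separately.\<close>
    then have "finite {x. (\<Sum>i\<le>2 * N. d i * x ^ i) = 0}" unfolding polyfun_finite_roots by simp
    then have "finite (mode 1 -` {x. (\<Sum>i\<le>2 * N. d i * x ^ i) = 0} \<inter> {0..<1})"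
      by (rule finite_vimage_IntI[OF _ inj_on_mode_1])
    then have "finite (insert 1 (mode 1 -` {x. (\<Sum>i\<le>2 * N. d i * x ^ i) = 0} \<inter> {0..<1}))" by simp
    moreover have "{t \<in> {0..1}. Re (demod f N t) = 0}
        \<subseteq> insert 1 (mode 1 -` {x. (\<Sum>i\<le>2 * N. d i * x ^ i) = 0} \<inter> {0..<1})"
      unfolding zero_iff by auto
    ultimately show ?thesis using finite_subset by blast
  qed
qed

end

section \<open>The phase increment\<close>

lemma deriv01_eqI:
  assumes "(g has_vector_derivative d) (at t within {0..1})" "t \<in> {0..1}"
  shows "deriv01 g t = d"
  unfolding deriv01_def using vector_derivative_within_cbox[of 0 1 t g d] assms by simp

lemma C1_01_D:
  assumes "C1_01 g" "t \<in> {0..1}"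
  shows "(g has_vector_derivative deriv01 g t) (at t within {0..1})"
  using assms unfolding C1_01_def deriv01_def by (simp add: vector_derivative_works)

interpretation standard: phase_coordinate "\<lambda>t. t" "\<lambda>_. 1"
  by unfold_locales auto

lemma standard_coef: "standard.coef = fourier"
  by (simp add: standard.coef_def[abs_def] fourier_def[abs_def] standard.mode_def)

text \<open>The imaginary part of the logarithmic derivative is the derivative of the argument.
  Unlike the quotient inside the arctan, it stays meaningful where Re z = 0 and z \<noteq>
  0.\<close>

lemma arctan_quotient_deriv:
  assumes z: "(z has_vector_derivative z') (at t within S)" and nz: "Re (z t) \<noteq> 0"
  shows "((\<lambda>s. arctan (Im (z s) / Re (z s))) has_vector_derivative Im (z' / z t)) (at t within S)"
proof -
  have R: "((\<lambda>s. Re (z s)) has_real_derivative Re z') (at t within S)"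
    and I: "((\<lambda>s. Im (z s)) has_real_derivative Im z') (at t within S)"
    using bounded_linear.has_vector_derivative[OF bounded_linear_Re z]
      bounded_linear.has_vector_derivative[OF bounded_linear_Im z]
    by (simp_all add: has_real_derivative_iff_has_vector_derivative)
  have "((\<lambda>s. arctan (Im (z s) / Re (z s))) has_real_derivative
      (Im z' * Re (z t) - Im (z t) * Re z') / (Re (z t) * Re (z t)) *
      inverse (1 + (Im (z t) / Re (z t))\<^sup>2)) (at t within S)"
    by (rule derivative_eq_intros R I nz refl | simp)+
  moreover have "(Im z' * Re (z t) - Im (z t) * Re z') / (Re (z t) * Re (z t)) *
      inverse (1 + (Im (z t) / Re (z t))\<^sup>2) = Im (z' / z t)"
  proof -
    have "(Re (z t) * Re (z t)) * (1 + (Im (z t) / Re (z t))\<^sup>2) = (Re (z t))\<^sup>2 + (Im (z t))\<^sup>2"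
      using nz by (simp add: field_simps power2_eq_square)
    then show ?thesis by (simp add: Im_divide divide_inverse mult.assoc flip: inverse_mult_distrib) (simp add: algebra_simps)
  qed
  ultimately show ?thesis by (simp add: has_real_derivative_iff_has_vector_derivative)
qed

text \<open>
  Where \<open>Re z\<close> vanishes identically, \<open>arctan (Im z / Re z)\<close> is \<open>arctan 0 = 0\<close> by the
  convention for division by 0, and \<open>Im (z' / z) = 0\<close> as well.
\<close>

lemma fourier_arctan_quotient:
  fixes z z' :: "real \<Rightarrow> complex" and \<psi> \<psi>' r :: "real \<Rightarrow> real"
  assumes z: "\<And>t. t \<in> {0..1} \<Longrightarrow> (z has_vector_derivative z' t) (at t within {0..1})"
    and z'_cont: "continuous_on {0..1} z'" and z_per: "z 0 = z 1"
    and psi: "\<And>t. t \<in> {0..1} \<Longrightarrow> (\<psi> has_vector_derivative \<psi>' t) (at t within {0..1})"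
    and psi'_cont: "continuous_on {0..1} \<psi>'" and psi_per: "cis (\<psi> 0) = cis (\<psi> 1)"
    and zeros: "(\<forall>t. Re (z t) = 0) \<or> finite {t \<in> {0..1}. Re (z t) = 0}"
    and r: "\<And>t. t \<in> {0..1} \<Longrightarrow> c \<le> r t" and close: "\<And>t. t \<in> {0..1} \<Longrightarrow> norm (z t - r t * cis (\<psi> t)) \<le> \<epsilon>"
    and c: "c > 0" and \<epsilon>: "\<epsilon> \<le> c / 2"
  shows "norm (fourier (\<lambda>t. of_real (deriv01 (\<lambda>s. arctan (Im (z s) / Re (z s))) t)) k
      - fourier (\<lambda>t. of_real (\<psi>' t)) k) \<le> 2 * pi * \<bar>of_int k\<bar> * (2 * \<epsilon> / c)"
proof -
  \<comment> \<open>Removing the phase \<open>\<psi>\<close> leaves a function close to the positive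
    number \<open>r t\<close>, hence in the right half plane. Its argument \<open>E\<close> is
    therefore an arctan without branch jumps.\<close>
  define w where "w t = z t * cis (- \<psi> t)" for t
  define w' where "w' t = (z' t - \<i> * \<psi>' t * z t) * cis (- \<psi> t)" for t
  define E where "E t = arctan (Im (w t) / Re (w t))" for t
  define E' where "E' t = Im (z' t / z t) - \<psi>' t" for t
  have cis_deriv: "((\<lambda>t. cis (- \<psi> t)) has_vector_derivative - \<i> * \<psi>' t * cis (- \<psi> t)) (at t within {0..1})"
    if "t \<in> {0..1}" for t
  proof -
    have "((\<lambda>t. - \<psi> t) has_derivative (\<lambda>h. - (h * \<psi>' t))) (at t within {0..1})"
      using psi[OF that] by (intro has_derivative_minus) (simp add: has_vector_derivative_def)
    from has_derivative_cis[OF this] show ?thesis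
      unfolding has_vector_derivative_def
      by (rule has_derivative_eq_rhs) (simp add: fun_eq_iff scaleR_conv_of_real mult_ac)
  qed
  have w: "(w has_vector_derivative w' t) (at t within {0..1})" if "t \<in> {0..1}" for t
    using has_vector_derivative_mult[OF z[OF that] cis_deriv[OF that]]
    unfolding w_def w'_def by (simp add: algebra_simps)
  have w_close: "norm (w t - r t) \<le> \<epsilon>" if "t \<in> {0..1}" for t
  proof -
    have "w t - r t = (z t - r t * cis (\<psi> t)) * cis (- \<psi> t)"
      by (simp add: w_def algebra_simps cis_mult)
    then show ?thesis using close[OF that] by (simp add: norm_mult)
  qed
  have "\<epsilon> \<ge> 0" using order_trans[OF norm_ge_zero w_close[of 0]] by simp
  have Re_w: "Re (w t) \<ge> c / 2" if "t \<in> {0..1}" for t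
    using abs_Re_le_cmod[of "w t - r t"] w_close[OF that] r[OF that] \<epsilon> by auto
  have Im_w: "\<bar>Im (w t)\<bar> \<le> \<epsilon>" if "t \<in> {0..1}" for t
    using abs_Im_le_cmod[of "w t - r t"] w_close[OF that] by auto
  have w_nz: "Re (w t) \<noteq> 0" if "t \<in> {0..1}" for t using Re_w[OF that] c by auto
  have z_nz: "z t \<noteq> 0" if "t \<in> {0..1}" for t
    using w_nz[OF that] by (auto simp: w_def)
  have E: "(E has_vector_derivative E' t) (at t within {0..1})" if "t \<in> {0..1}" for t
  proof -
    have "w' t / w t = z' t / z t - \<i> * \<psi>' t"
      using z_nz[OF that] by (simp add: w_def w'_def diff_divide_distrib)
    then have "Im (w' t / w t) = E' t" by (simp add: E'_def)
    then show ?thesis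
      using arctan_quotient_deriv[OF w[OF that] w_nz[OF that]] unfolding E_def by simp
  qed
  have z_cont: "continuous_on {0..1} z" using z by (rule continuous_on_vector_derivative)
  have E'_cont: "continuous_on {0..1} E'"
    unfolding E'_def using z_nz by (intro continuous_intros z'_cont z_cont psi'_cont) auto
  have E_cont: "continuous_on {0..1} E" using E by (rule continuous_on_vector_derivative)
  \<comment> \<open>\<open>\<psi>\<close> itself may change by a multiple of 2 pi, but
    \<open>E\<close> sees it only through \<open>cis\<close>.\<close>
  have E_per: "E 0 = E 1"
  proof -
    have "cis (- \<psi> 0) = cis (- \<psi> 1)" using psi_per by (simp add: cis_cnj[symmetric])
    then show ?thesis using z_per by (simp add: E_def w_def)
  qed
  have E_le: "\<bar>E t\<bar> \<le> 2 * \<epsilon> / c" if "t \<in> {0..1}" for t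
  proof -
    have "\<bar>E t\<bar> \<le> \<bar>Im (w t)\<bar> / \<bar>Re (w t)\<bar>"
      unfolding E_def using abs_arctan_le[of "Im (w t) / Re (w t)"] by simp
    also have "\<dots> \<le> \<epsilon> / (c / 2)"
      using Re_w[OF that] Im_w[OF that] c \<open>\<epsilon> \<ge> 0\<close> by (intro frac_le) auto
    finally show ?thesis by (simp add: mult.commute)
  qed
  let ?q = "\<lambda>t. deriv01 (\<lambda>s. arctan (Im (z s) / Re (z s))) t"
  \<comment> \<open>The arctan can jump where Re z vanishes. Unless Re z vanishes identically this
    happens at finitely many times, which no integral sees.\<close>
  have q: "\<exists>S. finite S \<and> (\<forall>t\<in>{0..1} - S. ?q t = Im (z' t / z t))"
    using zeros
  proof
    assume zero: "\<forall>t. Re (z t) = 0"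
    have "?q t = Im (z' t / z t)" if t: "t \<in> {0..1}" for t
    proof -
      have "((\<lambda>s. Re (z s)) has_vector_derivative Re (z' t)) (at t within {0..1})"
        using bounded_linear.has_vector_derivative[OF bounded_linear_Re z[OF t]] .
      then have "Re (z' t) = 0" using deriv01_eqI[of "\<lambda>_. 0" "Re (z' t)" t] deriv01_eqI[of "\<lambda>_. 0" 0 t] t zero by simp
      then have "Im (z' t / z t) = 0" using zero by (simp add: Im_divide)
      moreover have "?q t = 0" using zero t by (intro deriv01_eqI) auto
      ultimately show ?thesis by simp
    qed
    then show ?thesis by (intro exI[of _ "{}"]) auto
  next
    assume "finite {t \<in> {0..1}. Re (z t) = 0}"
    then show ?thesis
      by (intro exI[of _ "{t \<in> {0..1}. Re (z t) = 0}"]) (auto intro!: deriv01_eqI arctan_quotient_deriv z)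
  qed
  then obtain S where S: "finite S" "\<And>t. t \<in> {0..1} - S \<Longrightarrow> ?q t = Im (z' t / z t)" by blast
  have "fourier (\<lambda>t. of_real (?q t)) k = fourier (\<lambda>t. of_real (Im (z' t / z t))) k"
    unfolding fourier_def by (rule integral_spike[OF negligible_finite[OF S(1)]]) (simp add: S(2))
  also have "\<dots> = fourier (\<lambda>t. of_real (\<psi>' t)) k + fourier (\<lambda>t. of_real (E' t)) k"
  proof -
    have "((\<lambda>t. of_real (\<psi>' t) * cis (- (2 * pi * of_int k * t)) + of_real (E' t) * cis (- (2 * pi * of_int k * t)))
        has_integral fourier (\<lambda>t. of_real (\<psi>' t)) k + fourier (\<lambda>t. of_real (E' t)) k) {0..1}"
      unfolding fourier_def
      by (intro has_integral_add integrable_integral integrable_continuous_interval continuous_intros psi'_cont E'_cont)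
    then show ?thesis unfolding fourier_def[of "\<lambda>t. of_real (Im (z' t / z t))"]
      by (intro integral_unique) (simp add: E'_def algebra_simps)
  qed
  finally have "norm (fourier (\<lambda>t. of_real (?q t)) k - fourier (\<lambda>t. of_real (\<psi>' t)) k)
      = norm (fourier (\<lambda>t. of_real (E' t)) k)" by simp
  \<comment> \<open>For k = 0 periodicity of \<open>E\<close> makes the mean of \<open>E'\<close>
    vanish. Otherwise integration by parts trades \<open>E'\<close>, for which no size estimate is
    available, for a factor 2 pi |k| and the uniform bound on \<open>E\<close>.\<close>
  also have "\<dots> \<le> 2 * pi * \<bar>of_int k\<bar> * (2 * \<epsilon> / c)"
  proof (cases "k = 0")
    case True
    have "((\<lambda>t. complex_of_real (E' t)) has_integral of_real (E 1 - E 0)) {0..1}"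
      by (intro has_integral_of_real fundamental_theorem_of_calculus E) auto
    then show ?thesis using True E_per by (simp add: fourier_def integral_unique)
  next
    case False
    have Ec: "((\<lambda>s. complex_of_real (E s)) has_vector_derivative of_real (E' t)) (at t within {0..1})"
      if "t \<in> {0..1}" for t
      using E[OF that] by (intro has_vector_derivative_of_real)
        (simp add: has_real_derivative_iff_has_vector_derivative)
    have "fourier (\<lambda>t. of_real (E t)) k = fourier (\<lambda>t. of_real (E' t)) k / (2 * pi * \<i> * of_int k)"
      using standard.coef_by_parts[OF Ec, of k] E_per False E'_cont
      by (simp add: standard_coef continuous_intros)
    then have "fourier (\<lambda>t. of_real (E' t)) k = (2 * pi * \<i> * of_int k) * fourier (\<lambda>t. of_real (E t)) k"
      using False by simp
    then have "norm (fourier (\<lambda>t. of_real (E' t)) k) = 2 * pi * \<bar>of_int k\<bar> * norm (fourier (\<lambda>t. of_real (E t)) k)"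
      by (simp add: norm_mult)
    also have "\<dots> \<le> 2 * pi * \<bar>of_int k\<bar> * (2 * \<epsilon> / c)"
    proof (intro mult_left_mono)
      have "norm (fourier (\<lambda>t. of_real (E t)) k) \<le> (2 * \<epsilon> / c) * (1 - 0)"
        unfolding fourier_def
        by (rule integral_bound) (auto simp: norm_mult E_le intro!: continuous_intros E_cont)
      then show "norm (fourier (\<lambda>t. of_real (E t)) k) \<le> 2 * \<epsilon> / c" by simp
    qed auto
    finally show ?thesis .
  qed
  finally show ?thesis .
qed

section \<open>Normalized phases as coordinates\<close>

lemma num_periods_pos:
  assumes "C1_01 \<phi>" "\<And>t. t \<in> {0..1} \<Longrightarrow> deriv01 \<phi> t > 0"
  shows "num_periods \<phi> > 0"
proof -
  have deriv: "(\<phi> has_real_derivative deriv01 \<phi> t) (at t within {0..1})" if "t \<in> {0..1}" for t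
    using C1_01_D[OF assms(1) that] by (simp add: has_real_derivative_iff_has_vector_derivative)
  have "\<exists>y. (\<phi> has_real_derivative y) (at x) \<and> 0 < y" if "0 < x" "x < 1" for x
    using that deriv[of x] assms(2)[of x] at_within_Icc_at[of 0 x 1] by (intro exI[of _ "deriv01 \<phi> x"]) auto
  moreover have "continuous_on {0..1} \<phi>" using deriv by (rule DERIV_continuous_on)
  ultimately have "\<phi> 0 < \<phi> 1"
    using DERIV_pos_imp_increasing_open[of 0 1 \<phi>] by auto
  then show ?thesis by (simp add: num_periods_def)
qed

lemma deriv01_normalized_phase:
  assumes "C1_01 \<phi>" "t \<in> {0..1}"
  shows "(normalized_phase \<phi> has_vector_derivative deriv01 \<phi> t / (2 * pi * num_periods \<phi>)) (at t within {0..1})"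
    and "deriv01 (normalized_phase \<phi>) t = deriv01 \<phi> t / (2 * pi * num_periods \<phi>)"
proof -
  show *: "(normalized_phase \<phi> has_vector_derivative deriv01 \<phi> t / (2 * pi * num_periods \<phi>)) (at t within {0..1})"
    using C1_01_D[OF assms] unfolding normalized_phase_def[abs_def] divide_inverse
    by (auto intro!: derivative_eq_intros simp: has_real_derivative_iff_has_vector_derivative[symmetric])
  then show "deriv01 (normalized_phase \<phi>) t = deriv01 \<phi> t / (2 * pi * num_periods \<phi>)"
    using assms(2) by (rule deriv01_eqI)
qed

lemma phase_coordinate_normalized_phase:
  assumes "C1_01 \<phi>" "\<And>t. t \<in> {0..1} \<Longrightarrow> deriv01 \<phi> t > 0"
  shows "phase_coordinate (normalized_phase \<phi>) (deriv01 (normalized_phase \<phi>))"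
proof
  note P = num_periods_pos[OF assms]
  show "normalized_phase \<phi> 0 = 0" by (simp add: normalized_phase_def)
  show "normalized_phase \<phi> 1 = 1" using P by (auto simp: normalized_phase_def num_periods_def)
  show "(normalized_phase \<phi> has_real_derivative deriv01 (normalized_phase \<phi>) t) (at t within {0..1})"
    if "t \<in> {0..1}" for t
    using deriv01_normalized_phase[OF assms(1) that] by (simp add: has_real_derivative_iff_has_vector_derivative)
  have "continuous_on {0..1} (\<lambda>t. deriv01 \<phi> t / (2 * pi * num_periods \<phi>))"
    using assms(1) P by (intro continuous_intros) (auto simp: C1_01_def)
  then show "continuous_on {0..1} (deriv01 (normalized_phase \<phi>))"
    by (rule continuous_on_eq) (simp add: deriv01_normalized_phase(2)[OF assms(1)])
  show "0 < deriv01 (normalized_phase \<phi>) t" if "t \<in> {0..1}" for t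
    using assms(2)[OF that] P by (simp add: deriv01_normalized_phase(2)[OF assms(1) that])
qed

text \<open>With a whole number of periods, the two shifted sums are \<open>S\<close> and its
  conjugate, so a = S + cnj S = 2 Re S and b = -i (S - cnj S) = 2 Im S.\<close>

lemma env_eq_demod:
  fixes f \<phi> :: "real \<Rightarrow> real"
  assumes "C1_01 \<phi>" "\<And>t. t \<in> {0..1} \<Longrightarrow> deriv01 \<phi> t > 0" and N: "num_periods \<phi> = real N"
  defines "z \<equiv> phase_coordinate.demod (normalized_phase \<phi>) (deriv01 (normalized_phase \<phi>)) f N"
  shows "env_cos f \<phi> t = Re (z t)" "env_sin f \<phi> t = Im (z t)"
proof -
  interpret P: phase_coordinate "normalized_phase \<phi>" "deriv01 (normalized_phase \<phi>)"
    by (rule phase_coordinate_normalized_phase[OF assms(1,2)])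
  have "N > 0" using num_periods_pos[OF assms(1,2)] N by simp
  let ?W = "{k :: int. 2 * \<bar>k\<bar> < int N}"
  let ?c = "P.coef (\<lambda>s. of_real (f s))"
  have c: "phase_fourier \<phi> f (of_int k) = ?c k" for k
    by (simp add: phase_fourier_def P.coef_def P.mode_def)
  have c': "phase_fourier \<phi> f (of_int k + real N) = ?c (k + int N)"
    "phase_fourier \<phi> f (of_int k - real N) = ?c (k - int N)" for k
    using c[of "k + int N"] c[of "k - int N"] by simp_all
  have chi: "chi (of_int k / real N) = (if k \<in> ?W then 1 else 0)" for k
    using \<open>N > 0\<close> unfolding chi_def by (auto simp: field_simps abs_if split: if_splits)
  have sum: "infsum (\<lambda>k. g k * of_real (chi (of_int k / num_periods \<phi>)) *
      cis (2 * pi * of_int k * normalized_phase \<phi> t)) UNIV = (\<Sum>k\<in>?W. g k * P.mode k t)" for g :: "int \<Rightarrow> complex"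
  proof -
    have "infsum (\<lambda>k. g k * of_real (chi (of_int k / num_periods \<phi>)) *
        cis (2 * pi * of_int k * normalized_phase \<phi> t)) UNIV = infsum (\<lambda>k. g k * P.mode k t) ?W"
      unfolding N chi P.mode_def by (rule infsum_cong_neutral) auto
    then show ?thesis using P.finite_band by simp
  qed
  define S where "S = (\<Sum>k\<in>?W. ?c (k + int N) * P.mode k t)"
  have S': "(\<Sum>k\<in>?W. ?c (k - int N) * P.mode k t) = cnj S"
    unfolding S_def by (rule P.cnj_demod_sum[symmetric])
  have "env_cos f \<phi> t = Re (\<Sum>k\<in>?W. (?c (k + int N) + ?c (k - int N)) * P.mode k t)"
    unfolding env_cos_def sum by (simp add: N c')
  also have "(\<Sum>k\<in>?W. (?c (k + int N) + ?c (k - int N)) * P.mode k t) = S + cnj S"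
    unfolding S'[symmetric] unfolding S_def by (simp only: distrib_right sum.distrib)
  finally show "env_cos f \<phi> t = Re (z t)"
    by (simp add: z_def P.demod_def S_def[symmetric])
  have "env_sin f \<phi> t = Re (\<Sum>k\<in>?W. - \<i> * (?c (k + int N) - ?c (k - int N)) * P.mode k t)"
    unfolding env_sin_def sum by (simp add: N c')
  also have "(\<Sum>k\<in>?W. - \<i> * (?c (k + int N) - ?c (k - int N)) * P.mode k t) = - \<i> * (S - cnj S)"
    unfolding S'[symmetric] unfolding S_def
    by (simp only: left_diff_distrib sum_subtractf sum_distrib_left mult.assoc right_diff_distrib)
  finally show "env_sin f \<phi> t = Im (z t)"
    by (simp add: z_def P.demod_def S_def[symmetric])
qed

text \<open>This turns decay in the coordinate of \<open>\<theta>\<close> into pointwise bounds,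
  which can then be read in the coordinate of the current phase by comparing densities.\<close>

lemma C1_if_phase_fourier_summable:
  fixes g :: "real \<Rightarrow> real"
  assumes \<theta>: "C1_01 \<theta>" "\<And>t. t \<in> {0..1} \<Longrightarrow> deriv01 \<theta> t > 0" and g: "continuous_on {0..1} g"
    and summable: "(\<lambda>k. \<bar>of_int k\<bar> * norm (phase_fourier \<theta> g (of_int k))) summable_on UNIV"
    and S: "(\<Sum>\<^sub>\<infinity>k. \<bar>of_int k\<bar> * norm (phase_fourier \<theta> g (of_int k))) \<le> S"
  obtains g' where "\<And>t. t \<in> {0..1} \<Longrightarrow> (g has_vector_derivative g' t) (at t within {0..1})"
    "continuous_on {0..1} g'" "g 0 = g 1"
    "\<And>t. t \<in> {0..1} \<Longrightarrow> \<bar>g' t\<bar> \<le> 2 * pi * S * deriv01 (normalized_phase \<theta>) t"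
proof -
  interpret P: phase_coordinate "normalized_phase \<theta>" "deriv01 (normalized_phase \<theta>)"
    by (rule phase_coordinate_normalized_phase[OF \<theta>])
  let ?G = "\<lambda>t. complex_of_real (g t)"
  have c: "P.coef ?G k = phase_fourier \<theta> g (of_int k)" for k
    by (simp add: phase_fourier_def P.coef_def P.mode_def)
  have "continuous_on {0..1} ?G" by (intro continuous_intros g)
  then show thesis
  proof (rule P.C1_if_summable[where g = ?G, unfolded c, OF _ summable])
    fix G' assume G': "\<And>t. t \<in> {0..1} \<Longrightarrow> (?G has_vector_derivative G' t) (at t within {0..1})"
      "continuous_on {0..1} G'"
      "\<And>t. t \<in> {0..1} \<Longrightarrow> norm (G' t) \<le> 2 * pi * (\<Sum>\<^sub>\<infinity>k. \<bar>of_int k\<bar> * norm (phase_fourier \<theta> g (of_int k)))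
        * deriv01 (normalized_phase \<theta>) t"
      "?G 0 = ?G 1"
    show thesis
    proof (rule that)
      show "(g has_vector_derivative Re (G' t)) (at t within {0..1})" if "t \<in> {0..1}" for t
        using bounded_linear.has_vector_derivative[OF bounded_linear_Re G'(1)[OF that]] by simp
      show "continuous_on {0..1} (\<lambda>t. Re (G' t))" by (intro continuous_intros G')
      show "g 0 = g 1" using G'(4) by simp
      show "\<bar>Re (G' t)\<bar> \<le> 2 * pi * S * deriv01 (normalized_phase \<theta>) t" if "t \<in> {0..1}" for t
      proof -
        have "\<bar>Re (G' t)\<bar> \<le> norm (G' t)" by (rule abs_Re_le_cmod)
        also note G'(3)[OF that]
        also have "2 * pi * (\<Sum>\<^sub>\<infinity>k. \<bar>of_int k\<bar> * norm (phase_fourier \<theta> g (of_int k))) * deriv01 (normalized_phase \<theta>) t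
            \<le> 2 * pi * S * deriv01 (normalized_phase \<theta>) t"
          using S P.deriv_pos[OF that] by (intro mult_right_mono mult_left_mono) auto
        finally show ?thesis .
      qed
    qed
  qed
qed

text \<open>As \<open>K\<close> is at most pi L / 2, the densities of both phases are comparable, so
  the derivative bounds for \<open>f0\<close> and \<open>G\<close> in the coordinate of
  \<open>\<phi>\<close> do not involve L. The demodulation error is then of order 1 / sqrt L, below
  \<open>\<epsilon>\<close>, and the argument estimate applies.\<close>

lemma fourier_phase_increment:
  fixes f f0 f1 \<theta> \<phi> :: "real \<Rightarrow> real" and S F K c \<epsilon> :: real
  assumes f: "\<And>t. t \<in> {0..1} \<Longrightarrow> f t = f0 t + f1 t * cos (\<theta> t)"
    and \<theta>: "C1_01 \<theta>" "\<And>t. t \<in> {0..1} \<Longrightarrow> deriv01 \<theta> t > 0" "num_periods \<theta> = real L"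
    and \<phi>: "C1_01 \<phi>" "\<And>t. t \<in> {0..1} \<Longrightarrow> deriv01 \<phi> t > 0" "num_periods \<phi> = real N"
    and f0: "continuous_on {0..1} f0"
      "(\<lambda>k. \<bar>of_int k\<bar> * norm (phase_fourier \<theta> f0 (of_int k))) summable_on UNIV"
      "(\<Sum>\<^sub>\<infinity>k. \<bar>of_int k\<bar> * norm (phase_fourier \<theta> f0 (of_int k))) \<le> S"
    and f1: "continuous_on {0..1} f1"
      "(\<lambda>k. \<bar>of_int k\<bar> * norm (phase_fourier \<theta> f1 (of_int k))) summable_on UNIV"
      "(\<Sum>\<^sub>\<infinity>k. \<bar>of_int k\<bar> * norm (phase_fourier \<theta> f1 (of_int k))) \<le> S"
    and c: "c > 0" "\<And>t. t \<in> {0..1} \<Longrightarrow> c \<le> f1 t" and F: "\<And>t. t \<in> {0..1} \<Longrightarrow> f1 t \<le> F"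
    and K: "\<And>t. t \<in> {0..1} \<Longrightarrow> \<bar>deriv01 \<theta> t - deriv01 \<phi> t\<bar> \<le> K" "K \<le> pi * L / 2"
    and \<theta>_L: "\<And>t. t \<in> {0..1} \<Longrightarrow> \<bar>deriv01 \<theta> t - 2 * pi * L\<bar> \<le> pi * L / 2"
    and \<epsilon>: "16 * (10 * pi * S + 3 * F * K) / sqrt L \<le> \<epsilon>" "\<epsilon> \<le> c / 2"
  shows "norm (fourier (\<lambda>t. of_real (deriv01 (\<lambda>s. arctan (env_sin f \<phi> s / env_cos f \<phi> s)) t)) k
      - fourier (\<lambda>t. of_real (deriv01 \<theta> t - deriv01 \<phi> t)) k) \<le> 2 * pi * \<bar>of_int k\<bar> * (2 * \<epsilon> / c)"
proof -
  interpret P: phase_coordinate "normalized_phase \<phi>" "deriv01 (normalized_phase \<phi>)"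
    by (rule phase_coordinate_normalized_phase[OF \<phi>(1,2)])
  let ?u' = "deriv01 (normalized_phase \<phi>)"
  have "K \<ge> 0" using K(1)[of 0] by auto
  have "F > 0" using c(2)[of 0] F[of 0] c(1) by auto
  have L: "L > 0" using num_periods_pos[OF \<theta>(1,2)] \<theta>(3) by simp
  have N: "N > 0" using num_periods_pos[OF \<phi>(1,2)] \<phi>(3) by simp
  \<comment> \<open>\<open>\<theta>'\<close> lies between 3/2 pi L and 5/2 pi L, and
    \<open>\<phi>'\<close> is within pi L / 2 of it.\<close>
  have \<phi>_L: "pi * L \<le> deriv01 \<phi> t" "deriv01 \<theta> t \<le> 3 * pi * L" if "t \<in> {0..1}" for t
    using K(1)[OF that] K(2) \<theta>_L[OF that] by linarith+
  have int_\<theta>: "((\<lambda>t. deriv01 \<theta> t) has_integral 2 * pi * L) {0..1}"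
    and int_\<phi>: "((\<lambda>t. deriv01 \<phi> t) has_integral 2 * pi * N) {0..1}"
    using fundamental_theorem_of_calculus[of 0 1 \<theta> "deriv01 \<theta>"] C1_01_D[OF \<theta>(1)] \<theta>(3)
      fundamental_theorem_of_calculus[of 0 1 \<phi> "deriv01 \<phi>"] C1_01_D[OF \<phi>(1)] \<phi>(3)
    by (auto simp: num_periods_def field_simps)
  have int_diff: "((\<lambda>t. deriv01 \<theta> t - deriv01 \<phi> t) has_integral 2 * pi * L - 2 * pi * N) {0..1}"
    by (intro has_integral_diff int_\<theta> int_\<phi>)
  \<comment> \<open>Integrating the frequency difference over [0,1] compares the two numbers of
    periods.\<close>
  then have "\<bar>2 * pi * L - 2 * pi * N\<bar> \<le> K"
    using has_integral_bound[OF \<open>K \<ge> 0\<close>, of "\<lambda>t. deriv01 \<theta> t - deriv01 \<phi> t" "2 * pi * L - 2 * pi * N" 0 1] K(1)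
    by simp
  then have *: "\<bar>2 * pi * L - 2 * pi * N\<bar> \<le> pi * L / 2" using K(2) by simp
  have "pi * N \<le> pi * (3 / 2 * L)" "pi * (L / 2) \<le> pi * N" using * by linarith+
  then have NL: "N \<le> 3 / 2 * L" "L / 2 \<le> N" using pi_gt_zero by (auto simp only: mult_le_cancel_left_pos)
  have u'_lower: "1 / 3 \<le> ?u' t" if "t \<in> {0..1}" for t
  proof -
    have "2 * pi * real N \<le> 3 * (pi * L)" using NL(1) pi_gt_zero by simp
    also have "\<dots> \<le> 3 * deriv01 \<phi> t" using \<phi>_L(1)[OF that] by simp
    finally show ?thesis using N by (simp add: deriv01_normalized_phase(2)[OF \<phi>(1) that] \<phi>(3) field_simps)
  qed
  \<comment> \<open>The density of \<open>\<theta>\<close> is at most 3/2, which is below 5 times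
    the lower bound 1/3 for the density of \<open>\<phi>\<close>.\<close>
  have v'_upper: "deriv01 (normalized_phase \<theta>) t \<le> 5 * ?u' t" if "t \<in> {0..1}" for t
  proof -
    have "deriv01 (normalized_phase \<theta>) t \<le> 3 / 2"
      using \<phi>_L(2)[OF that] L by (simp add: deriv01_normalized_phase(2)[OF \<theta>(1) that] \<theta>(3) field_simps)
    then show ?thesis using u'_lower[OF that] by simp
  qed
  obtain f0' where f0': "\<And>t. t \<in> {0..1} \<Longrightarrow> (f0 has_vector_derivative f0' t) (at t within {0..1})"
    "continuous_on {0..1} f0'" "f0 0 = f0 1"
    "\<And>t. t \<in> {0..1} \<Longrightarrow> \<bar>f0' t\<bar> \<le> 2 * pi * S * deriv01 (normalized_phase \<theta>) t"
    using C1_if_phase_fourier_summable[OF \<theta>(1,2) f0] by blast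
  obtain f1' where f1': "\<And>t. t \<in> {0..1} \<Longrightarrow> (f1 has_vector_derivative f1' t) (at t within {0..1})"
    "continuous_on {0..1} f1'" "f1 0 = f1 1"
    "\<And>t. t \<in> {0..1} \<Longrightarrow> \<bar>f1' t\<bar> \<le> 2 * pi * S * deriv01 (normalized_phase \<theta>) t"
    using C1_if_phase_fourier_summable[OF \<theta>(1,2) f1] by blast
  have "infsum (\<lambda>k. \<bar>of_int k\<bar> * norm (phase_fourier \<theta> f0 (of_int k))) (UNIV :: int set) \<ge> 0"
    by (rule infsum_nonneg) auto
  then have "S \<ge> 0" using f0(3) by linarith
  \<comment> \<open>The first term is 2 pi S times the density ratio 5; the second bounds the
    derivative of the phase factor, F K, against a density of at least 1/3.\<close>
  define D where "D = 10 * pi * S + 3 * F * K"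
  have decay_bound: "2 * pi * S * deriv01 (normalized_phase \<theta>) t \<le> 10 * pi * S * ?u' t" if "t \<in> {0..1}" for t
    using mult_left_mono[OF v'_upper[OF that], of "2 * pi * S"] \<open>S \<ge> 0\<close> by simp
  \<comment> \<open>Normalized phases start at 0; the shift by \<open>\<phi> 0\<close> makes
    \<open>G\<close> times mode N exactly \<open>f1\<close> times \<open>cis\<close> of
    \<open>\<theta>\<close>.\<close>
  define \<psi> where "\<psi> t = \<theta> t - \<phi> t + \<phi> 0" for t
  define \<psi>' where "\<psi>' t = deriv01 \<theta> t - deriv01 \<phi> t" for t
  define G where "G t = of_real (f1 t) * cis (\<psi> t)" for t
  define G' where "G' t = of_real (f1 t) * (\<i> * \<psi>' t * cis (\<psi> t)) + of_real (f1' t) * cis (\<psi> t)" for t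
  have \<psi>: "(\<psi> has_vector_derivative \<psi>' t) (at t within {0..1})" if "t \<in> {0..1}" for t
  proof -
    have "((\<lambda>t. \<theta> t - \<phi> t + \<phi> 0) has_vector_derivative deriv01 \<theta> t - deriv01 \<phi> t + 0) (at t within {0..1})"
      by (intro has_vector_derivative_add has_vector_derivative_diff has_vector_derivative_const
        C1_01_D \<theta> \<phi> that)
    then show ?thesis by (simp add: \<psi>_def[abs_def] \<psi>'_def)
  qed
  have \<psi>'_cont: "continuous_on {0..1} \<psi>'"
    unfolding \<psi>'_def using \<theta>(1) \<phi>(1) by (intro continuous_intros) (auto simp: C1_01_def)
  have \<psi>_cont: "continuous_on {0..1} \<psi>" using \<psi> by (rule continuous_on_vector_derivative)
  have \<psi>_per: "cis (\<psi> 0) = cis (\<psi> 1)"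
  proof -
    have "\<theta> 1 = \<theta> 0 + 2 * pi * L" "\<phi> 1 = \<phi> 0 + 2 * pi * N"
      using \<theta>(3) \<phi>(3) by (auto simp: num_periods_def field_simps)
    then have "\<psi> 1 = \<psi> 0 + 2 * pi * of_int (int L - int N)"
      by (simp add: \<psi>_def algebra_simps)
    then have "cis (\<psi> 1) = cis (\<psi> 0) * cis (2 * pi * of_int (int L - int N))"
      by (simp only: cis_mult)
    also have "cis (2 * pi * of_int (int L - int N)) = 1" by (rule cis_multiple_2pi) auto
    finally show ?thesis by simp
  qed
  have cis_\<psi>: "((\<lambda>t. cis (\<psi> t)) has_vector_derivative \<i> * \<psi>' t * cis (\<psi> t)) (at t within {0..1})"
    if "t \<in> {0..1}" for t
  proof -
    have "(\<psi> has_derivative (\<lambda>h. h * \<psi>' t)) (at t within {0..1})"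
      using \<psi>[OF that] by (simp add: has_vector_derivative_def)
    from has_derivative_cis[OF this] show ?thesis
      unfolding has_vector_derivative_def
      by (rule has_derivative_eq_rhs) (simp add: fun_eq_iff scaleR_conv_of_real mult_ac)
  qed
  have G: "(G has_vector_derivative G' t) (at t within {0..1})" if "t \<in> {0..1}" for t
    unfolding G_def[abs_def] G'_def
    by (intro has_vector_derivative_mult cis_\<psi> that has_vector_derivative_of_real)
       (simp add: has_real_derivative_iff_has_vector_derivative f1'(1)[OF that])
  have G'_cont: "continuous_on {0..1} G'"
    unfolding G'_def by (intro continuous_intros f1 f1' \<psi>_cont \<psi>'_cont)
  have G_per: "G 0 = G 1" by (simp add: G_def f1'(3) \<psi>_per)
  have G'_le: "norm (G' t) \<le> D * ?u' t" if t: "t \<in> {0..1}" for t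
  proof -
    have "norm (G' t) \<le> norm (of_real (f1 t) * (\<i> * \<psi>' t * cis (\<psi> t))) + norm (of_real (f1' t) * cis (\<psi> t))"
      unfolding G'_def by (rule norm_triangle_ineq)
    also have "\<dots> = \<bar>f1 t\<bar> * \<bar>\<psi>' t\<bar> + \<bar>f1' t\<bar>" by (simp add: norm_mult)
    also have "\<dots> \<le> F * K + 10 * pi * S * ?u' t"
      using c(2)[OF t] F[OF t] c(1) K(1)[OF t] order_trans[OF f1'(4)[OF t] decay_bound[OF t]]
      by (intro add_mono mult_mono) (auto simp: \<psi>'_def)
    also have "F * K \<le> (3 * F * K) * ?u' t"
      using mult_left_mono[OF u'_lower[OF t], of "3 * F * K"] \<open>K \<ge> 0\<close> \<open>F > 0\<close> by simp
    finally show ?thesis by (simp add: D_def algebra_simps)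
  qed
  have f0'_le: "\<bar>f0' t\<bar> \<le> D * ?u' t" if t: "t \<in> {0..1}" for t
  proof -
    have "\<bar>f0' t\<bar> \<le> 10 * pi * S * ?u' t" using f0'(4)[OF t] decay_bound[OF t] by linarith
    also have "\<dots> \<le> D * ?u' t"
      using P.deriv_pos[OF t] \<open>K \<ge> 0\<close> \<open>F > 0\<close> by (intro mult_right_mono) (auto simp: D_def)
    finally show ?thesis .
  qed
  have f_G: "f t = f0 t + Re (G t * P.mode (int N) t)" if "t \<in> {0..1}" for t
  proof -
    have "2 * pi * real N * normalized_phase \<phi> t = \<phi> t - \<phi> 0"
      using N by (simp add: normalized_phase_def \<phi>(3))
    then have "G t * P.mode (int N) t = of_real (f1 t) * cis (\<theta> t)"
      by (simp add: G_def P.mode_def mult.assoc cis_mult \<psi>_def)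
    then show ?thesis using f[OF that] by simp
  qed
  let ?z = "P.demod f N"
  have "D \<ge> 0" using \<open>S \<ge> 0\<close> \<open>K \<ge> 0\<close> \<open>F > 0\<close> by (simp add: D_def)
  have close: "norm (?z t - of_real (f1 t) * cis (\<psi> t)) \<le> \<epsilon>" if "t \<in> {0..1}" for t
  proof -
    have "norm (?z t - G t) \<le> 8 * D / sqrt N"
      by (rule P.norm_demod_diff_le[OF f_G N f0'(1-3) f0'_le G G'_cont G_per G'_le that])
    also have "\<dots> \<le> 8 * D * (2 / sqrt L)"
    proof -
      have "sqrt L \<le> sqrt (4 * N)" using NL by simp
      then have "sqrt L \<le> 2 * sqrt N" by (simp add: real_sqrt_mult)
      then have "1 / sqrt N \<le> 2 / sqrt L" using N L by (simp add: field_simps)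
      then show ?thesis using mult_left_mono[of "1 / sqrt N" "2 / sqrt L" "8 * D"] \<open>D \<ge> 0\<close> by simp
    qed
    also have "\<dots> \<le> \<epsilon>" using \<epsilon>(1) by (simp add: D_def)
    finally show ?thesis by (simp add: G_def)
  qed
  obtain z' where z': "\<And>t. t \<in> {0..1} \<Longrightarrow> (?z has_vector_derivative z' t) (at t within {0..1})"
    "continuous_on {0..1} z'" "?z 0 = ?z 1"
    using P.demod_C1 by blast
  have env: "env_sin f \<phi> = (\<lambda>t. Im (?z t))" "env_cos f \<phi> = (\<lambda>t. Re (?z t))"
    by (rule ext, rule env_eq_demod[OF \<phi>], simp)+
  show ?thesis
    unfolding env
    using fourier_arctan_quotient[OF z' \<psi> \<psi>'_cont \<psi>_per P.demod_Re_zeros c(2) close c(1) \<epsilon>(2), of k]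
    by (simp add: \<psi>'_def)
qed

section \<open>Fourier coefficients in time, trigonometric polynomials and the l1 norm\<close>

lemma fourier_diff:
  assumes "continuous_on {0..1} a" "continuous_on {0..1} b"
  shows "fourier (\<lambda>t. of_real (a t - b t)) k = fourier (\<lambda>t. of_real (a t)) k - fourier (\<lambda>t. of_real (b t)) k"
proof -
  have "((\<lambda>t. of_real (a t) * cis (- (2 * pi * of_int k * t)) - of_real (b t) * cis (- (2 * pi * of_int k * t)))
      has_integral fourier (\<lambda>t. of_real (a t)) k - fourier (\<lambda>t. of_real (b t)) k) {0..1}"
    unfolding fourier_def
    by (intro has_integral_diff integrable_integral integrable_continuous_interval continuous_intros assms)
  then show ?thesis unfolding fourier_def[of "\<lambda>t. of_real (a t - b t)"]
    by (intro integral_unique) (simp add: algebra_simps)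
qed

lemma fourier_cong:
  assumes "\<And>t. t \<in> {0..1} \<Longrightarrow> g t = h t"
  shows "fourier g k = fourier h k"
  unfolding fourier_def by (rule integral_cong) (simp add: assms)

lemma fourier_trig_poly:
  assumes "\<And>t. t \<in> {0..1} \<Longrightarrow> g t = (\<Sum>k = - int M..int M. c k * cis (2 * pi * of_int k * t))"
  shows "fourier g j = (if \<bar>j\<bar> \<le> int M then c j else 0)"
proof -
  have "((\<lambda>t. \<Sum>k = - int M..int M. c k * cis (2 * pi * of_int (k - j) * t)) has_integral
      (\<Sum>k = - int M..int M. c k * (if k - j = 0 then 1 else 0))) {0..1}"
    by (intro has_integral_sum has_integral_mult_right has_integral_cis) auto
  moreover have "(\<Sum>k = - int M..int M. c k * (if k - j = 0 then 1 else 0)) = (if \<bar>j\<bar> \<le> int M then c j else 0)"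
    by (auto simp: sum.delta if_distrib cong: if_cong)
  ultimately have *: "((\<lambda>t. \<Sum>k = - int M..int M. c k * cis (2 * pi * of_int (k - j) * t)) has_integral
      (if \<bar>j\<bar> \<le> int M then c j else 0)) {0..1}" by (simp only:)
  have "(\<Sum>k = - int M..int M. c k * cis (2 * pi * of_int (k - j) * t)) = g t * cis (- (2 * pi * of_int j * t))"
    if "t \<in> {0..1}" for t
    unfolding assms[OF that] sum_distrib_right
    by (intro sum.cong refl) (simp add: mult.assoc cis_mult algebra_simps)
  then have "((\<lambda>t. g t * cis (- (2 * pi * of_int j * t))) has_integral (if \<bar>j\<bar> \<le> int M then c j else 0)) {0..1}"
    using * by (rule has_integral_eq)
  then show ?thesis unfolding fourier_def by (rule integral_unique)
qed

lemma cnj_fourier_of_real: "cnj (fourier (\<lambda>t. of_real (g t)) k) = fourier (\<lambda>t. of_real (g t)) (- k)"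
  by (simp add: fourier_def integral_cnj cis_cnj)

lemma of_real_Re_trig_proj:
  "of_real (Re (trig_proj M (\<lambda>s. of_real (g s)) t)) = trig_proj M (\<lambda>s. of_real (g s)) t"
proof -
  have "cnj (trig_proj M (\<lambda>s. of_real (g s)) t) = trig_proj M (\<lambda>s. of_real (g s)) t"
    unfolding trig_proj_def cnj_sum complex_cnj_mult cnj_fourier_of_real cis_cnj
    by (rule sum.reindex_bij_witness[of _ uminus uminus]) auto
  then show ?thesis by (simp add: complex_eq_iff)
qed

text \<open>Inversion bounds the uniform norm by the sum of the coefficients; bounds on finite sums
  supply the summability that inversion asks for.\<close>

lemma norm_le_if_fourier_sums_le:
  assumes g: "continuous_on {0..1} g" and B: "\<And>J. finite J \<Longrightarrow> (\<Sum>k\<in>J. norm (fourier g k)) \<le> B"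
    and t: "t \<in> {0..1}"
  shows "norm (g t) \<le> B"
proof -
  have summable: "(\<lambda>k. norm (fourier g k)) summable_on UNIV"
    by (rule nonneg_bdd_above_summable_on) (auto intro!: bdd_aboveI2 B)
  have "((\<lambda>k. fourier g k * standard.mode k t) has_sum g t) UNIV"
    using standard.inversion[unfolded standard_coef, OF g summable t] .
  moreover have "((\<lambda>k. norm (fourier g k * standard.mode k t)) has_sum (\<Sum>\<^sub>\<infinity>k. norm (fourier g k))) UNIV"
    using has_sum_infsum[OF summable] by (simp add: norm_mult)
  ultimately have "norm (g t) \<le> (\<Sum>\<^sub>\<infinity>k. norm (fourier g k))" by (rule norm_has_sum_bound[rotated])
  also have "\<dots> \<le> B" using summable by (rule infsum_le_finite_sums) (rule B)
  finally show ?thesis .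
qed

lemma l1_norm_le:
  assumes "\<And>J. finite J \<Longrightarrow> (\<Sum>k\<in>J. norm (c k)) \<le> B"
  shows "l1_norm c \<le> ennreal B"
  unfolding l1_norm_def
  by (rule infsum_le_finite_sums[OF nonneg_summable_on_complete]) (auto intro!: ennreal_leI assms)

lemma sum_norm_le_l1_norm:
  assumes "l1_norm c \<le> ennreal B" "B \<ge> 0" "finite J"
  shows "(\<Sum>k\<in>J. norm (c k)) \<le> B"
proof -
  have "ennreal (\<Sum>k\<in>J. norm (c k)) = infsum (\<lambda>k. ennreal (norm (c k))) J"
    using \<open>finite J\<close> by simp
  also have "\<dots> \<le> l1_norm c"
    unfolding l1_norm_def by (rule infsum_mono_neutral) (auto intro!: nonneg_summable_on_complete)
  also note assms(1)
  finally show ?thesis using assms(2) by (simp add: ennreal_le_iff)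
qed

section \<open>Sums of decaying coefficients\<close>

lemma powr_decay_le_inverse_square:
  assumes "norm (a :: complex) \<le> C * \<bar>of_int k\<bar> powr (- p)" "k \<noteq> 0" "p \<ge> 4" "C \<ge> 0"
  shows "norm a \<le> C * (1 / (of_int k)\<^sup>2)" "\<bar>of_int k\<bar> * norm a \<le> C * (1 / (of_int k)\<^sup>2)"
proof -
  define x where "x = \<bar>of_int k :: real\<bar>"
  have x: "x \<ge> 1" using assms(2) by (simp add: x_def)
  have sq: "x powr (- 2) = 1 / (of_int k)\<^sup>2"
    using x by (simp add: powr_minus powr_numeral x_def divide_inverse)
  \<comment> \<open>For p \<ge> 4 inverse squares dominate even after the weight |k|, which gives
    bounds uniform in p.\<close>
  have "x powr (- p) \<le> x powr (- 2)" using x assms(3) by (intro powr_mono) auto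
  then show "norm a \<le> C * (1 / (of_int k)\<^sup>2)"
    using assms(1,4) unfolding sq[symmetric] x_def[symmetric] by (meson mult_left_mono order_trans)
  have "x * norm a \<le> x * (C * x powr (- p))"
    using assms(1) x unfolding x_def[symmetric] by (intro mult_left_mono) auto
  also have "\<dots> = C * x powr (1 - p)" using x by (simp add: powr_diff powr_minus field_simps)
  also have "\<dots> \<le> C * x powr (- 2)" using x assms(3,4) by (intro mult_left_mono powr_mono) auto
  finally show "\<bar>of_int k\<bar> * norm a \<le> C * (1 / (of_int k)\<^sup>2)" unfolding sq unfolding x_def .
qed

lemma sum_inverse_square_bound_le:
  fixes b :: "int \<Rightarrow> real"
  assumes "finite J" "\<And>k. k \<in> J \<Longrightarrow> k \<noteq> 0 \<Longrightarrow> b k \<le> C * (1 / (of_int k)\<^sup>2)" "b 0 = 0" "C \<ge> 0"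
  shows "sum b J \<le> 4 * C"
proof -
  have "sum b J = sum b (J - {0})"
    using assms(1,3) by (intro sum.mono_neutral_right) auto
  also have "\<dots> \<le> (\<Sum>k\<in>J - {0}. C * (1 / (of_int k)\<^sup>2))"
    by (intro sum_mono assms(2)) auto
  also have "\<dots> = C * (\<Sum>k\<in>J - {0}. 1 / (of_int k)\<^sup>2)"
    by (simp add: sum_distrib_left)
  also have "\<dots> \<le> C * (4 / real 1)"
    using assms(1,4) by (intro mult_left_mono sum_inverse_squares_le) auto
  finally show ?thesis by simp
qed

lemma weighted_decay_summable:
  assumes "\<And>k. k \<noteq> 0 \<Longrightarrow> norm (a k :: complex) \<le> C * \<bar>of_int k\<bar> powr (- p)" "p \<ge> 4" "C \<ge> 0"
  shows "(\<lambda>k. \<bar>of_int k\<bar> * norm (a k)) summable_on UNIV" (is ?A)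
    and "(\<Sum>\<^sub>\<infinity>k. \<bar>of_int k\<bar> * norm (a k)) \<le> 4 * C"
proof -
  have *: "(\<Sum>k\<in>J. \<bar>of_int k\<bar> * norm (a k)) \<le> 4 * C" if "finite J" for J
    by (rule sum_inverse_square_bound_le[OF that])
       (use powr_decay_le_inverse_square(2)[OF assms(1)] assms in auto)
  show ?A by (rule nonneg_bdd_above_summable_on) (auto intro!: bdd_aboveI2 *)
  then show "(\<Sum>\<^sub>\<infinity>k. \<bar>of_int k\<bar> * norm (a k)) \<le> 4 * C"
    by (rule infsum_le_finite_sums) (rule *)
qed

text \<open>By the mean value theorem each term is at most a difference of values of x powr (1 - p)
  / (p - 1) at consecutive integers, and these differences telescope.\<close>

lemma sum_powr_tail_le:
  assumes M: "M \<ge> 1" and p: "p > 1"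
  shows "(\<Sum>j = Suc M..m. real j powr (- p)) \<le> real M powr (1 - p) / (p - 1)"
proof -
  have summand: "real (Suc j) powr (- p) \<le> (real j powr (1 - p) - real (Suc j) powr (1 - p)) / (p - 1)"
    if "j \<ge> 1" for j
  proof -
    have "((\<lambda>x. x powr (1 - p)) has_real_derivative (1 - p) * x powr (- p)) (at x)" if "x \<ge> real j" for x
      using has_real_derivative_powr[of x "1 - p"] that \<open>j \<ge> 1\<close> by simp
    then obtain z where z: "real j < z" "z < real (Suc j)"
      "real (Suc j) powr (1 - p) - real j powr (1 - p) = (real (Suc j) - real j) * ((1 - p) * z powr (- p))"
      using MVT2[of "real j" "real (Suc j)" "\<lambda>x. x powr (1 - p)" "\<lambda>x. (1 - p) * x powr (- p)"] by auto
    have "real (Suc j) powr (- p) \<le> z powr (- p)"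
      using z p by (intro powr_mono2') auto
    also have "\<dots> = (real j powr (1 - p) - real (Suc j) powr (1 - p)) / (p - 1)"
      using z(3) p by (simp add: field_simps)
    finally show ?thesis .
  qed
  have "(\<Sum>j = Suc M..m. real j powr (- p)) \<le> (real M powr (1 - p) - real m powr (1 - p)) / (p - 1)" if "m \<ge> M"
    using that
  proof (induction m rule: dec_induct)
    case (step m)
    have "(\<Sum>j = Suc M..Suc m. real j powr (- p)) = (\<Sum>j = Suc M..m. real j powr (- p)) + real (Suc m) powr (- p)"
      using step.hyps by simp
    also have "\<dots> \<le> (real M powr (1 - p) - real m powr (1 - p)) / (p - 1)
        + (real m powr (1 - p) - real (Suc m) powr (1 - p)) / (p - 1)"
      using step.IH summand[of m] step.hyps M by (intro add_mono) auto
    finally show ?case by (simp add: add_divide_distrib[symmetric])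
  qed simp
  moreover have "(real M powr (1 - p) - real m powr (1 - p)) / (p - 1) \<le> real M powr (1 - p) / (p - 1)"
    using p by (intro divide_right_mono) auto
  ultimately show ?thesis
    using p by (cases "m \<ge> M") (auto intro: order_trans)
qed

section \<open>One update of the phase\<close>

lemma initial_phase_D:
  assumes "initial_phase M \<phi>"
  shows "C1_01 \<phi>" "t \<in> {0..1} \<Longrightarrow> deriv01 \<phi> t > 0" "num_periods \<phi> \<in> \<nat>"
  using assms by (auto simp: initial_phase_def)

text \<open>The first part lets the update be added mode by mode. By the second, the modes of the
  error beyond \<open>M\<close> come from \<open>\<theta>\<close> alone.\<close>

lemma initial_phase_fourier:
  assumes "initial_phase M \<phi>" "t \<in> {0..1}"
  shows "of_real (deriv01 \<phi> t) = (\<Sum>k = - int M..int M. fourier (\<lambda>t. of_real (deriv01 \<phi> t)) k * cis (2 * pi * of_int k * t))"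
    and "\<bar>k\<bar> > int M \<Longrightarrow> fourier (\<lambda>t. of_real (deriv01 \<phi> t)) k = 0"
proof -
  obtain c :: "int \<Rightarrow> complex" where c: "\<And>t. t \<in> {0..1} \<Longrightarrow>
      of_real (deriv01 \<phi> t) = (\<Sum>k = - int M..int M. c k * cis (2 * pi * of_int k * t))"
    using assms(1) by (auto simp: initial_phase_def trig_space_def)
  have *: "fourier (\<lambda>t. of_real (deriv01 \<phi> t)) j = (if \<bar>j\<bar> \<le> int M then c j else 0)" for j
    by (rule fourier_trig_poly[OF c])
  show "of_real (deriv01 \<phi> t) = (\<Sum>k = - int M..int M. fourier (\<lambda>t. of_real (deriv01 \<phi> t)) k * cis (2 * pi * of_int k * t))"
    unfolding c[OF assms(2)] by (intro sum.cong refl) (auto simp: *)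
  show "\<bar>k\<bar> > int M \<Longrightarrow> fourier (\<lambda>t. of_real (deriv01 \<phi> t)) k = 0" by (simp add: *)
qed

text \<open>
  The update replaces the low modes of \<open>\<phi>'\<close> by those of \<open>\<theta>'\<close> up to an error
  governed by \<open>\<eta>\<close>, and leaves only the high modes of \<open>\<theta>'\<close> unmatched. The new frequency is
  then uniformly close to \<open>\<theta>'\<close>, hence positive, so that the full step is admissible.
\<close>

lemma next_phase_error:
  fixes f \<theta> \<phi> :: "real \<Rightarrow> real" and M :: nat and \<eta> h :: real
  assumes \<theta>: "C1_01 \<theta>" "num_periods \<theta> \<in> \<nat>"
    and \<phi>: "initial_phase M \<phi>"
    and close: "\<And>k. norm (fourier (\<lambda>t. of_real (deriv01 (\<lambda>s. arctan (env_sin f \<phi> s / env_cos f \<phi> s)) t)) k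
      - fourier (\<lambda>t. of_real (deriv01 \<theta> t - deriv01 \<phi> t)) k) \<le> 2 * pi * \<bar>of_int k\<bar> * \<eta>"
    and \<eta>: "\<eta> \<ge> 0"
    and h: "\<And>J. finite J \<Longrightarrow> (\<And>k. k \<in> J \<Longrightarrow> \<bar>k\<bar> > int M) \<Longrightarrow>
      (\<Sum>k\<in>J. norm (fourier (\<lambda>t. of_real (deriv01 \<theta> t)) k)) \<le> h"
    and pos: "\<And>t. t \<in> {0..1} \<Longrightarrow> (2 * M + 1) * (2 * pi * M * \<eta>) + h < deriv01 \<theta> t"
  shows "initial_phase M (next_phase M f \<phi>)"
    and "freq_error (next_phase M f \<phi>) \<theta> \<le> ennreal ((2 * M + 1) * (2 * pi * M * \<eta>) + h)"
proof -
  let ?q = "\<lambda>t. deriv01 (\<lambda>s. arctan (env_sin f \<phi> s / env_cos f \<phi> s)) t"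
  let ?Q = "fourier (\<lambda>t. of_real (?q t))"
  let ?F = "\<lambda>g. fourier (\<lambda>t. of_real (deriv01 g t))"
  let ?B = "(2 * M + 1) * (2 * pi * M * \<eta>) + h"
  note \<phi>_C1 = initial_phase_D(1)[OF \<phi>]
  note \<phi>_pos = initial_phase_D(2)[OF \<phi>]
  have \<phi>'_cont: "continuous_on {0..1} (deriv01 \<phi>)" and \<theta>'_cont: "continuous_on {0..1} (deriv01 \<theta>)"
    using \<phi>_C1 \<theta>(1) by (auto simp: C1_01_def)
  define r where "r = phase_incr_deriv M f \<phi>"
  have r: "of_real (r t) = (\<Sum>k = - int M..int M. ?Q k * cis (2 * pi * of_int k * t))" for t
    unfolding r_def phase_incr_deriv_def of_real_Re_trig_proj by (simp add: trig_proj_def)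
  have r_cont: "continuous_on {0..1} r"
    unfolding r_def phase_incr_deriv_def trig_proj_def by (intro continuous_intros)
  have incr: "(phase_incr M f \<phi> has_vector_derivative r t) (at t within {0..1})" if "t \<in> {0..1}" for t
    using integral_has_vector_derivative[OF r_cont that] by (simp add: phase_incr_def[abs_def] r_def)
  have step_deriv: "((\<lambda>s. \<phi> s + \<alpha> * phase_incr M f \<phi> s) has_vector_derivative deriv01 \<phi> t + \<alpha> * r t)
      (at t within {0..1})" if "t \<in> {0..1}" for \<alpha> t
    by (intro has_vector_derivative_add C1_01_D[OF \<phi>_C1] has_vector_derivative_mult_right incr that)
  \<comment> \<open>The frequency after a full step. It is analysed first; its positivity then
    determines the step size.\<close>
  define \<xi>' where "\<xi>' t = deriv01 \<phi> t + r t" for t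
  have \<xi>'_cont: "continuous_on {0..1} \<xi>'" unfolding \<xi>'_def by (intro continuous_intros \<phi>'_cont r_cont)
  have \<xi>'_poly: "of_real (\<xi>' t) = (\<Sum>k = - int M..int M. (?F \<phi> k + ?Q k) * cis (2 * pi * of_int k * t))"
    if "t \<in> {0..1}" for t
    by (simp add: \<xi>'_def initial_phase_fourier(1)[OF \<phi> that] r sum.distrib distrib_right)
  define e where "e = fourier (\<lambda>t. of_real (\<xi>' t - deriv01 \<theta> t))"
  have e: "e k = (if \<bar>k\<bar> \<le> int M then ?F \<phi> k + ?Q k else 0) - ?F \<theta> k" for k
    unfolding e_def fourier_diff[OF \<xi>'_cont \<theta>'_cont] by (subst fourier_trig_poly[OF \<xi>'_poly]) auto
  have e_low: "norm (e k) \<le> 2 * pi * \<bar>of_int k\<bar> * \<eta>" if "\<bar>k\<bar> \<le> int M" for k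
    using close[of k] that unfolding e fourier_diff[OF \<theta>'_cont \<phi>'_cont] by (simp add: algebra_simps)
  have e_high: "norm (e k) = norm (?F \<theta> k)" if "\<bar>k\<bar> > int M" for k
    using that by (simp add: e)
  have e_sum: "(\<Sum>k\<in>J. norm (e k)) \<le> ?B" if J: "finite J" for J
  proof -
    let ?W = "{- int M..int M}"
    have "(\<Sum>k\<in>J. norm (e k)) = (\<Sum>k\<in>J \<inter> ?W. norm (e k)) + (\<Sum>k\<in>J - ?W. norm (e k))"
      using J by (rule sum.Int_Diff)
    also have "(\<Sum>k\<in>J \<inter> ?W. norm (e k)) \<le> (\<Sum>k\<in>?W. norm (e k))"
      by (intro sum_mono2) auto
    \<comment> \<open>There are 2 M + 1 low modes, each with |k| \<le> M.\<close>
    also have "\<dots> \<le> (\<Sum>k\<in>?W. 2 * pi * M * \<eta>)"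
    proof (intro sum_mono)
      fix k assume k: "k \<in> ?W"
      then have "norm (e k) \<le> 2 * pi * \<bar>of_int k\<bar> * \<eta>" by (intro e_low) auto
      also have "\<dots> \<le> 2 * pi * M * \<eta>"
        using k \<eta> by (intro mult_right_mono mult_left_mono) auto
      finally show "norm (e k) \<le> 2 * pi * M * \<eta>" .
    qed
    also have "\<dots> = (2 * M + 1) * (2 * pi * M * \<eta>)" by simp
    also have "(\<Sum>k\<in>J - ?W. norm (e k)) = (\<Sum>k\<in>J - ?W. norm (?F \<theta> k))"
      by (intro sum.cong refl e_high) auto
    also have "\<dots> \<le> h" using J by (intro h) auto
    finally show ?thesis by simp
  qed
  have \<xi>'_close: "\<bar>\<xi>' t - deriv01 \<theta> t\<bar> \<le> ?B" if "t \<in> {0..1}" for t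
  proof -
    have "norm (complex_of_real (\<xi>' t - deriv01 \<theta> t)) \<le> ?B"
      by (rule norm_le_if_fourier_sums_le[OF _ e_sum[unfolded e_def] that])
         (intro continuous_intros \<xi>'_cont \<theta>'_cont)
    then show ?thesis by (simp only: norm_of_real)
  qed
  have \<xi>'_pos: "\<xi>' t > 0" if "t \<in> {0..1}" for t
    using \<xi>'_close[OF that] pos[OF that] by linarith
  \<comment> \<open>Positivity of \<open>\<xi>'\<close> admits \<open>\<alpha> = 1\<close>, the
    upper end of the allowed range.\<close>
  have "step_size M f \<phi> = 1"
    unfolding step_size_def
  proof (rule Greatest_equality)
    have "0 \<le> deriv01 (\<lambda>s. \<phi> s + 1 * phase_incr M f \<phi> s) t" if "t \<in> {0..1}" for t
      using deriv01_eqI[OF step_deriv[OF that, of 1] that] \<xi>'_pos[OF that] by (simp add: \<xi>'_def)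
    then show "(1::real) \<in> {0..1} \<and> (\<forall>t\<in>{0..1}. 0 \<le> deriv01 (\<lambda>s. \<phi> s + 1 * phase_incr M f \<phi> s) t)"
      by auto
  qed auto
  then have next_eq: "next_phase M f \<phi> = (\<lambda>t. \<phi> t + 1 * phase_incr M f \<phi> t)"
    by (simp add: next_phase_def[abs_def])
  define \<xi> where "\<xi> = next_phase M f \<phi>"
  have \<xi>: "(\<xi> has_vector_derivative \<xi>' t) (at t within {0..1})" if "t \<in> {0..1}" for t
    using step_deriv[OF that, of 1] unfolding \<xi>_def next_eq \<xi>'_def by simp
  have deriv_\<xi>: "deriv01 \<xi> t = \<xi>' t" if "t \<in> {0..1}" for t
    using \<xi>[OF that] that by (rule deriv01_eqI)
  have diff_deriv: "((\<lambda>s. \<xi> s - \<theta> s) has_vector_derivative \<xi>' t - deriv01 \<theta> t) (at t within {0..1})"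
    if "t \<in> {0..1}" for t
    by (intro has_vector_derivative_diff \<xi> C1_01_D[OF \<theta>(1)] that)
  have "fourier (\<lambda>t. of_real (deriv01 (\<lambda>s. \<xi> s - \<theta> s) t)) = e"
    unfolding e_def using deriv01_eqI[OF diff_deriv] by (intro ext fourier_cong) auto
  then show "freq_error (next_phase M f \<phi>) \<theta> \<le> ennreal ?B"
    unfolding freq_error_def \<xi>_def[symmetric] by (simp only:) (rule l1_norm_le[OF e_sum])
  have "num_periods \<xi> = num_periods \<theta>"
  proof -
    have "((\<lambda>t. complex_of_real (\<xi>' t - deriv01 \<theta> t)) has_integral of_real ((\<xi> 1 - \<theta> 1) - (\<xi> 0 - \<theta> 0))) {0..1}"
      by (intro has_integral_of_real fundamental_theorem_of_calculus diff_deriv) auto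
    then have "e 0 = of_real ((\<xi> 1 - \<theta> 1) - (\<xi> 0 - \<theta> 0))"
      by (simp add: e_def fourier_def integral_unique del: of_real_diff)
    \<comment> \<open>The low-mode bound carries the factor |k|, so the mean of
      \<open>\<theta>'\<close> is matched exactly and the number of periods stays whole.\<close>
    moreover have "e 0 = 0" using e_low[of 0] by simp
    ultimately have "(\<xi> 1 - \<theta> 1) - (\<xi> 0 - \<theta> 0) = 0" by (metis of_real_eq_0_iff)
    then show ?thesis by (simp add: num_periods_def)
  qed
  moreover have "C1_01 \<xi>"
    unfolding C1_01_def
  proof
    show "\<forall>t\<in>{0..1}. \<xi> differentiable at t within {0..1}"
      using \<xi> by (blast intro: differentiableI_vector)
    show "continuous_on {0..1} (deriv01 \<xi>)"
      using \<xi>'_cont by (rule continuous_on_eq) (simp add: deriv_\<xi>)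
  qed
  moreover have "\<exists>v\<in>trig_space M. \<forall>t\<in>{0..1}. of_real (deriv01 \<xi> t) = v t"
    unfolding trig_space_def using \<xi>'_poly deriv_\<xi>
    by (intro bexI[of _ "\<lambda>t. \<Sum>k = - int M..int M. (?F \<phi> k + ?Q k) * cis (2 * pi * of_int k * t)"]) auto
  ultimately show "initial_phase M (next_phase M f \<phi>)"
    unfolding \<xi>_def[symmetric] initial_phase_def using \<theta>(2) \<xi>'_pos deriv_\<xi> by auto
qed

section \<open>The recursive error bound\<close>

text \<open>The 2 counts both signs, and 1/3 bounds 1 / (p - 1). That 2/3 is below 1 leaves room for
  the low-frequency error later.\<close>

lemma sum_fourier_tail_le:
  assumes decay: "\<And>k. k \<noteq> 0 \<Longrightarrow> norm (a k :: complex) \<le> C * \<bar>of_int k\<bar> powr (- p)"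
    and p: "p \<ge> 4" and C: "C \<ge> 0" and M: "M \<ge> 1"
    and J: "finite J" "\<And>k. k \<in> J \<Longrightarrow> \<bar>k\<bar> > int M"
  shows "(\<Sum>k\<in>J. norm (a k)) \<le> 2 / 3 * (C * real M powr (- p + 1))"
proof -
  have "(\<Sum>j = Suc M..m. C * real j powr (- p)) \<le> C * (real M powr (- p + 1) / 3)" for m
  proof -
    have "(\<Sum>j = Suc M..m. real j powr (- p)) \<le> real M powr (1 - p) / (p - 1)"
      using sum_powr_tail_le[of M p m] M p by simp
    also have "\<dots> \<le> real M powr (1 - p) / 3"
      using p by (intro divide_left_mono) auto
    also have "1 - p = - p + 1" by simp
    finally show ?thesis
      unfolding sum_distrib_left[symmetric] using C by (intro mult_left_mono)
  qed
  then have "(\<Sum>k\<in>J. C * real (nat \<bar>k\<bar>) powr (- p)) \<le> 2 * (C * (real M powr (- p + 1) / 3))"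
    using J C by (intro sum_int_le_twice[where n = "Suc M" and h = "\<lambda>j. C * real j powr (- p)"]) force+
  moreover have "norm (a k) \<le> C * real (nat \<bar>k\<bar>) powr (- p)" if "k \<in> J" for k
    using decay[of k] J(2)[OF that] by simp
  then have "(\<Sum>k\<in>J. norm (a k)) \<le> (\<Sum>k\<in>J. C * real (nat \<bar>k\<bar>) powr (- p))"
    by (rule sum_mono)
  ultimately show ?thesis by simp
qed

text \<open>The mean of \<open>\<theta>'\<close> is 2 pi L, and its other modes sum to at most 4 C
  whatever L is. For large L the frequency is thus nearly constant relative to its size.\<close>

lemma deriv01_near_mean:
  assumes \<theta>: "C1_01 \<theta>" and L: "num_periods \<theta> = real L"
    and decay: "\<And>k. k \<noteq> 0 \<Longrightarrow> norm (fourier (\<lambda>t. of_real (deriv01 \<theta> t)) k) \<le> C * \<bar>of_int k\<bar> powr (- p)"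
    and p: "p \<ge> 4" and C: "C \<ge> 0" and t: "t \<in> {0..1}"
  shows "\<bar>deriv01 \<theta> t - 2 * pi * L\<bar> \<le> 4 * C"
proof -
  have cont: "continuous_on {0..1} (deriv01 \<theta>)" using \<theta> by (simp add: C1_01_def)
  have const: "fourier (\<lambda>t. of_real (2 * pi * L)) k = (if k = 0 then 2 * pi * L else 0)" for k
    by (subst fourier_trig_poly[of _ "\<lambda>_. 2 * pi * L" 0]) auto
  have "((\<lambda>t. complex_of_real (deriv01 \<theta> t)) has_integral of_real (\<theta> 1 - \<theta> 0)) {0..1}"
    using C1_01_D[OF \<theta>] by (intro has_integral_of_real fundamental_theorem_of_calculus) auto
  then have mean: "fourier (\<lambda>t. of_real (deriv01 \<theta> t)) 0 = of_real (2 * pi * L)"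
    using L by (simp add: fourier_def integral_unique num_periods_def field_simps del: of_real_diff of_real_mult)
  let ?a = "fourier (\<lambda>t. of_real (deriv01 \<theta> t - 2 * pi * L))"
  have a: "?a k = (if k = 0 then 0 else fourier (\<lambda>t. of_real (deriv01 \<theta> t)) k)" for k
    using fourier_diff[OF cont continuous_on_const, of "2 * pi * L" k] const[of k] mean by auto
  have "(\<Sum>k\<in>J. norm (?a k)) \<le> 4 * C" if "finite J" for J
  proof (rule sum_inverse_square_bound_le[OF that _ _ C])
    show "norm (?a k) \<le> C * (1 / (of_int k)\<^sup>2)" if "k \<noteq> 0" for k
      using powr_decay_le_inverse_square(1)[OF decay[OF that] that p C] unfolding a using that by simp
  qed (simp only: a, simp)
  then have "norm (complex_of_real (deriv01 \<theta> t - 2 * pi * L)) \<le> 4 * C"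
    using t by (intro norm_le_if_fourier_sums_le[where g = "\<lambda>t. complex_of_real (deriv01 \<theta> t - 2 * pi * L)"]
      continuous_intros cont) auto
  then show ?thesis by (simp only: norm_of_real)
qed

text \<open>Shaped as an induction step: the first and third conclusions restore the assumptions on
  \<open>\<phi>\<close>, the second is the recursion.\<close>

lemma freq_error_next_phase:
  fixes f f0 f1 \<theta> \<phi> :: "real \<Rightarrow> real" and M :: nat and C0 F K c \<epsilon> p :: real
  defines "T \<equiv> C0 * real M powr (- p + 1)"
  assumes C0: "C0 > 0" and M: "M \<ge> 1" and p: "p \<ge> 4"
    and f: "\<And>t. t \<in> {0..1} \<Longrightarrow> f t = f0 t + f1 t * cos (\<theta> t)"
    and f0: "continuous_on {0..1} f0" and f1: "continuous_on {0..1} f1"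
    and c: "c > 0" "\<And>t. t \<in> {0..1} \<Longrightarrow> c \<le> f1 t" and F: "\<And>t. t \<in> {0..1} \<Longrightarrow> f1 t \<le> F"
    and \<theta>: "C1_01 \<theta>" "\<And>t. t \<in> {0..1} \<Longrightarrow> deriv01 \<theta> t > 0" "num_periods \<theta> = real L"
    and decay: "\<And>k. k \<noteq> 0 \<Longrightarrow> norm (fourier (\<lambda>t. of_real (deriv01 \<theta> t)) k) \<le> C0 * \<bar>of_int k\<bar> powr (- p)"
      "\<And>k. k \<noteq> 0 \<Longrightarrow> norm (phase_fourier \<theta> f0 (of_int k)) \<le> C0 * \<bar>of_int k\<bar> powr (- p)"
      "\<And>k. k \<noteq> 0 \<Longrightarrow> norm (phase_fourier \<theta> f1 (of_int k)) \<le> C0 * \<bar>of_int k\<bar> powr (- p)"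
    and L: "8 * C0 \<le> pi * L" "2 * K \<le> pi * L"
    and \<epsilon>: "16 * (10 * pi * (4 * C0) + 3 * F * K) / sqrt L \<le> \<epsilon>" "0 \<le> \<epsilon>" "\<epsilon> \<le> c / 2"
      "(2 * M + 1) * (2 * pi * M * (2 * \<epsilon> / c)) \<le> T / 6"
    and K: "C0 \<le> K"
    and \<phi>: "initial_phase M \<phi>" "freq_error \<phi> \<theta> \<le> ennreal K"
  shows "initial_phase M (next_phase M f \<phi>)"
    and "freq_error (next_phase M f \<phi>) \<theta> \<le> ennreal (T / 2) + ennreal (1 / 2) * freq_error \<phi> \<theta>"
    and "freq_error (next_phase M f \<phi>) \<theta> \<le> ennreal K"
proof -
  have "K > 0" using C0 K by simp
  obtain err where err: "freq_error \<phi> \<theta> = ennreal err" "0 \<le> err"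
    using \<phi>(2) by (cases "freq_error \<phi> \<theta>") (auto simp: top_unique)
  then have "err \<le> K" using \<phi>(2) \<open>K > 0\<close> by (simp add: ennreal_le_iff)
  have "real M powr (- p + 1) \<le> real M powr 0" using M p by (intro powr_mono) auto
  then have T: "T > 0" "T \<le> C0" using M C0 by (auto simp: T_def)
  note \<phi>_C1 = initial_phase_D(1)[OF \<phi>(1)]
  note \<phi>_pos = initial_phase_D(2)[OF \<phi>(1)]
  obtain N where N: "num_periods \<phi> = real N" using initial_phase_D(3)[OF \<phi>(1)] by (auto elim: Nats_cases)
  have cont: "continuous_on {0..1} (deriv01 \<phi>)" "continuous_on {0..1} (deriv01 \<theta>)"
    using \<phi>_C1 \<theta>(1) by (auto simp: C1_01_def)
  let ?d = "fourier (\<lambda>t. of_real (deriv01 \<phi> t - deriv01 \<theta> t))"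
  have diff: "fourier (\<lambda>t. of_real (deriv01 (\<lambda>s. \<phi> s - \<theta> s) t)) k = ?d k" for k
  proof (rule fourier_cong)
    fix t :: real assume t: "t \<in> {0..1}"
    have "((\<lambda>s. \<phi> s - \<theta> s) has_vector_derivative deriv01 \<phi> t - deriv01 \<theta> t) (at t within {0..1})"
      by (intro has_vector_derivative_diff C1_01_D \<phi>_C1 \<theta> t)
    from deriv01_eqI[OF this t]
    show "complex_of_real (deriv01 (\<lambda>s. \<phi> s - \<theta> s) t) = of_real (deriv01 \<phi> t - deriv01 \<theta> t)" by simp
  qed
  have d_sum: "(\<Sum>k\<in>J. norm (?d k)) \<le> err" if "finite J" for J
  proof -
    have "(\<Sum>k\<in>J. norm (fourier (\<lambda>t. of_real (deriv01 (\<lambda>s. \<phi> s - \<theta> s) t)) k)) \<le> err"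
      by (rule sum_norm_le_l1_norm[OF _ err(2) that]) (use err(1) in \<open>simp add: freq_error_def\<close>)
    then show ?thesis by (simp only: diff)
  qed
  have close_K: "\<bar>deriv01 \<theta> t - deriv01 \<phi> t\<bar> \<le> K" if "t \<in> {0..1}" for t
  proof -
    have "norm (complex_of_real (deriv01 \<phi> t - deriv01 \<theta> t)) \<le> err"
      by (rule norm_le_if_fourier_sums_le[OF _ d_sum that]) (intro continuous_intros cont)
    then show ?thesis using \<open>err \<le> K\<close> by (simp only: norm_of_real abs_minus_commute[of "deriv01 \<theta> t"])
  qed
  have mean: "\<bar>deriv01 \<theta> t - 2 * pi * L\<bar> \<le> pi * L / 2" if "t \<in> {0..1}" for t
    using deriv01_near_mean[OF \<theta>(1,3) decay(1) p _ that] C0 L(1) by simp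
  have f0_decay: "(\<lambda>k. \<bar>of_int k\<bar> * norm (phase_fourier \<theta> f0 (of_int k))) summable_on UNIV"
      "(\<Sum>\<^sub>\<infinity>k. \<bar>of_int k\<bar> * norm (phase_fourier \<theta> f0 (of_int k))) \<le> 4 * C0"
    using weighted_decay_summable[of "\<lambda>k. phase_fourier \<theta> f0 (of_int k)" C0 p] decay(2) p C0 by auto
  have f1_decay: "(\<lambda>k. \<bar>of_int k\<bar> * norm (phase_fourier \<theta> f1 (of_int k))) summable_on UNIV"
      "(\<Sum>\<^sub>\<infinity>k. \<bar>of_int k\<bar> * norm (phase_fourier \<theta> f1 (of_int k))) \<le> 4 * C0"
    using weighted_decay_summable[of "\<lambda>k. phase_fourier \<theta> f1 (of_int k)" C0 p] decay(3) p C0 by auto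
  have "K \<le> pi * L / 2" using L(2) by simp
  note increment = fourier_phase_increment[OF f \<theta> \<phi>_C1 \<phi>_pos N f0 f0_decay f1 f1_decay c F close_K
    this mean \<epsilon>(1,3)]
  \<comment> \<open>The high modes of \<open>\<theta>'\<close> are bounded by decay and, since
    \<open>\<phi>'\<close> has none, also by the previous error.\<close>
  define h where "h = min err (2 / 3 * T)"
  have h: "(\<Sum>k\<in>J. norm (fourier (\<lambda>t. of_real (deriv01 \<theta> t)) k)) \<le> h"
    if J: "finite J" "\<And>k. k \<in> J \<Longrightarrow> \<bar>k\<bar> > int M" for J
  proof -
    have "norm (fourier (\<lambda>t. of_real (deriv01 \<theta> t)) k) = norm (?d k)" if "k \<in> J" for k
    proof -
      have "fourier (\<lambda>t. of_real (deriv01 \<phi> t)) k = 0"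
        by (rule initial_phase_fourier(2)[OF \<phi>(1), of 0]) (use J(2)[OF that] in auto)
      then show ?thesis by (simp only: fourier_diff[OF cont] diff_0 norm_minus_cancel)
    qed
    then have "(\<Sum>k\<in>J. norm (fourier (\<lambda>t. of_real (deriv01 \<theta> t)) k)) \<le> err"
      using d_sum[OF J(1)] by simp
    moreover have "(\<Sum>k\<in>J. norm (fourier (\<lambda>t. of_real (deriv01 \<theta> t)) k)) \<le> 2 / 3 * T"
      unfolding T_def by (rule sum_fourier_tail_le[OF decay(1) p _ M J]) (use C0 in auto)
    ultimately show ?thesis by (simp add: h_def)
  qed
  let ?B = "(2 * M + 1) * (2 * pi * M * (2 * \<epsilon> / c)) + h"
  \<comment> \<open>The error bound is below 8 C0, while \<open>\<theta>'\<close> is at least 3/2 pi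
    L and hence at least 8 C0.\<close>
  have pos: "?B < deriv01 \<theta> t" if "t \<in> {0..1}" for t
  proof -
    have "?B \<le> T / 6 + 2 / 3 * T" using \<epsilon>(4) by (intro add_mono) (auto simp: h_def)
    also have "\<dots> < 8 * C0" using T C0 by simp
    also have "\<dots> \<le> deriv01 \<theta> t" using mean[OF that] L(1) C0 by linarith
    finally show ?thesis .
  qed
  have "2 * \<epsilon> / c \<ge> 0" using \<epsilon>(2) c(1) by simp
  note next_phase = next_phase_error[OF \<theta>(1) _ \<phi>(1) increment this h pos]
  have nat: "num_periods \<theta> \<in> \<nat>" using \<theta>(3) by simp
  show "initial_phase M (next_phase M f \<phi>)"
    using nat by (rule next_phase(1))
  have "freq_error (next_phase M f \<phi>) \<theta> \<le> ennreal ?B"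
    using nat by (rule next_phase(2))
  \<comment> \<open>A minimum is at most the average, so h \<le> err / 2 + T / 3; the T / 6 from the
    low modes completes T / 2.\<close>
  also have "?B \<le> T / 2 + 1 / 2 * err"
    using \<epsilon>(4) unfolding h_def by linarith
  finally have bound: "freq_error (next_phase M f \<phi>) \<theta> \<le> ennreal (T / 2 + 1 / 2 * err)"
    by (simp add: ennreal_leI)
  also have "\<dots> = ennreal (T / 2) + ennreal (1 / 2 * err)"
    by (rule ennreal_plus) (use T(1) err(2) in auto)
  also have "ennreal (1 / 2 * err) = ennreal (1 / 2) * freq_error \<phi> \<theta>"
    unfolding err(1) by (rule ennreal_mult) (use err(2) in auto)
  finally show "freq_error (next_phase M f \<phi>) \<theta> \<le> ennreal (T / 2) + ennreal (1 / 2) * freq_error \<phi> \<theta>" .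
  \<comment> \<open>Since T \<le> C0 \<le> K, the average of \<open>T\<close> and \<open>err\<close>
    stays below \<open>K\<close>: the error ball is invariant.\<close>
  have "T / 2 + 1 / 2 * err \<le> K" using T(2) K \<open>err \<le> K\<close> by simp
  then show "freq_error (next_phase M f \<phi>) \<theta> \<le> ennreal K"
    using bound order_trans ennreal_leI by blast
qed

theorem theorem2p3:
  fixes C0 :: real and M0 :: nat and f1 :: "real \<Rightarrow> real"
  assumes "C0 > 0" and "M0 > 0"
    and "continuous_on {0..1} f1" and "\<forall>t\<in>{0..1}. f1 t > 0"
  shows "\<exists>\<Gamma>0 > 0. \<forall>p :: real. p \<ge> 4 \<longrightarrow> (\<exists>L0 :: real.
    \<forall>(f :: real \<Rightarrow> real) (f0 :: real \<Rightarrow> real) (\<theta> :: real \<Rightarrow> real) (\<theta>0 :: real \<Rightarrow> real).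
      (\<forall>t\<in>{0..1}. f t = f0 t + f1 t * cos (\<theta> t)) \<longrightarrow>
      f 0 = f 1 \<longrightarrow> num_periods \<theta> \<in> \<nat> \<longrightarrow>
      continuous_on {0..1} f0 \<longrightarrow>
      C1_01 \<theta> \<longrightarrow> (\<forall>t\<in>{0..1}. deriv01 \<theta> t > 0) \<longrightarrow>
      (\<forall>k :: int. k \<noteq> 0 \<longrightarrow>
         norm (fourier (\<lambda>t. of_real (deriv01 \<theta> t)) k) \<le> C0 * \<bar>of_int k\<bar> powr (- p) \<and>
         norm (phase_fourier \<theta> f0 (of_int k)) \<le> C0 * \<bar>of_int k\<bar> powr (- p) \<and>
         norm (phase_fourier \<theta> f1 (of_int k)) \<le> C0 * \<bar>of_int k\<bar> powr (- p)) \<longrightarrow>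
      num_periods \<theta> \<ge> L0 \<longrightarrow>
      initial_phase M0 \<theta>0 \<longrightarrow>
      freq_error \<theta>0 \<theta> \<le> ennreal (pi * real M0 / 2) \<longrightarrow>
      (\<forall>m :: nat. freq_error (phase_iter M0 f \<theta>0 (Suc m)) \<theta>
         \<le> ennreal (\<Gamma>0 * (num_periods \<theta> / 4) powr (- p + 2) + 1/2 * C0 * real M0 powr (- p + 1))
           + ennreal (1/2) * freq_error (phase_iter M0 f \<theta>0 m) \<theta>))"
proof -
  define M where "M = M0"
  have M: "M \<ge> 1" using assms(2) by (simp add: M_def)
  obtain t1 where t1: "t1 \<in> {0..1}" "\<forall>t\<in>{0..1}. f1 t1 \<le> f1 t"
    using continuous_attains_inf[of "{0..1}" f1] assms(3) by auto
  obtain t2 where t2: "\<forall>t\<in>{0..1}. f1 t \<le> f1 t2"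
    using continuous_attains_sup[of "{0..1}" f1] assms(3) by auto
  define c where "c = f1 t1"
  define F where "F = f1 t2"
  have c: "c > 0" "\<And>t. t \<in> {0..1} \<Longrightarrow> c \<le> f1 t" and F: "\<And>t. t \<in> {0..1} \<Longrightarrow> f1 t \<le> F"
    using t1 t2 assms(4) by (auto simp: c_def F_def)
  \<comment> \<open>The first entry covers the initial error; the second dominates
    \<open>T p\<close>, which makes the ball of radius \<open>K\<close> invariant.\<close>
  define K where "K = max (pi * M / 2) C0"
  define D where "D = 10 * pi * (4 * C0) + 3 * F * K"
  define T where "T p = C0 * real M powr (- p + 1)" for p
  have T: "T p > 0" for p using M assms(1) by (simp add: T_def)
  \<comment> \<open>With this value the bound on the low modes is exactly
    \<open>T p / 6\<close>.\<close>
  define \<eta> where "\<eta> p = T p / (6 * ((2 * M + 1) * (2 * pi * M)))" for p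
  have \<eta>: "\<eta> p > 0" "(2 * M + 1) * (2 * pi * M * \<eta> p) = T p / 6" for p
    using T[of p] M by (auto simp: \<eta>_def divide_simps)
  \<comment> \<open>The first entry keeps the demodulated signal away from 0, the second makes the
    argument error \<open>2 * \<epsilon> p / c\<close> at most \<open>\<eta> p\<close>.\<close>
  define \<epsilon> where "\<epsilon> p = min (c / 2) (\<eta> p * c / 2)" for p
  have \<epsilon>: "\<epsilon> p > 0" "\<epsilon> p \<le> c / 2" "2 * \<epsilon> p / c \<le> \<eta> p" for p
    using c(1) \<eta>(1)[of p] by (auto simp: \<epsilon>_def min_def field_simps)
  \<comment> \<open>The entries give, in order: L > 0 for dividing by sqrt L,
    \<open>\<theta>'\<close> close to its mean, \<open>\<phi>'\<close> comparable to
    \<open>\<theta>'\<close>, and a demodulation error of at most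
    \<open>\<epsilon> p\<close>.\<close>
  define L0 where "L0 p = Max {1, 8 * C0 / pi, 2 * K / pi, (16 * D / \<epsilon> p)\<^sup>2}" for p
  have bound: "freq_error (phase_iter M f \<theta>0 (Suc m)) \<theta>
      \<le> ennreal (1 * (num_periods \<theta> / 4) powr (- p + 2) + 1/2 * C0 * real M powr (- p + 1))
        + ennreal (1/2) * freq_error (phase_iter M f \<theta>0 m) \<theta>"
    if p: "p \<ge> 4" and f: "\<forall>t\<in>{0..1}. f t = f0 t + f1 t * cos (\<theta> t)"
      and f0: "continuous_on {0..1} f0" and nat: "num_periods \<theta> \<in> \<nat>"
      and \<theta>: "C1_01 \<theta>" "\<forall>t\<in>{0..1}. deriv01 \<theta> t > 0"
      and decay: "\<forall>k :: int. k \<noteq> 0 \<longrightarrow>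
         norm (fourier (\<lambda>t. of_real (deriv01 \<theta> t)) k) \<le> C0 * \<bar>of_int k\<bar> powr (- p) \<and>
         norm (phase_fourier \<theta> f0 (of_int k)) \<le> C0 * \<bar>of_int k\<bar> powr (- p) \<and>
         norm (phase_fourier \<theta> f1 (of_int k)) \<le> C0 * \<bar>of_int k\<bar> powr (- p)"
      and large: "num_periods \<theta> \<ge> L0 p"
      and init: "initial_phase M \<theta>0" "freq_error \<theta>0 \<theta> \<le> ennreal (pi * real M / 2)"
    for p and f f0 \<theta> \<theta>0 :: "real \<Rightarrow> real" and m :: nat
  proof -
    obtain L where L: "num_periods \<theta> = real L" using nat by (auto elim: Nats_cases)
    have large: "real L \<ge> 1" "real L \<ge> 8 * C0 / pi" "real L \<ge> 2 * K / pi" "real L \<ge> (16 * D / \<epsilon> p)\<^sup>2"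
      using large by (auto simp: L0_def L)
    have "16 * D / \<epsilon> p \<le> sqrt L" using large(4) by (rule real_le_rsqrt)
    then have eps1: "16 * D / sqrt L \<le> \<epsilon> p" using large(1) \<epsilon>(1)[of p] by (simp add: field_simps)
    have "(2 * M + 1) * (2 * pi * M * (2 * \<epsilon> p / c)) \<le> (2 * M + 1) * (2 * pi * M * \<eta> p)"
      by (intro mult_left_mono \<epsilon>(3)) auto
    then have eps2: "(2 * M + 1) * (2 * pi * M * (2 * \<epsilon> p / c)) \<le> T p / 6" unfolding \<eta>(2) .
    have L': "8 * C0 \<le> pi * L" "2 * K \<le> pi * L" using large by (auto simp: field_simps)
    note step = freq_error_next_phase[where f = f and ?f0.0 = f0 and ?f1.0 = f1 and \<theta> = \<theta> and M = M
      and ?C0.0 = C0 and F = F and K = K and c = c and \<epsilon> = "\<epsilon> p" and p = p and L = L,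
      OF assms(1) M p _ f0 assms(3) c F \<theta>(1) _ L _ _ _ L' eps1[unfolded D_def] less_imp_le[OF \<epsilon>(1)] \<epsilon>(2)
        eps2[unfolded T_def], folded T_def]
    \<comment> \<open>Every iterate stays in the same ball, so one choice of constants serves all
      steps.\<close>
    have inv: "initial_phase M (phase_iter M f \<theta>0 n) \<and> freq_error (phase_iter M f \<theta>0 n) \<theta> \<le> ennreal K" for n
    proof (induction n)
      case 0
      have "ennreal (pi * real M / 2) \<le> ennreal K" by (intro ennreal_leI) (simp add: K_def)
      then show ?case using init by (auto simp: phase_iter_def)
    next
      case (Suc n)
      then show ?case
        using step(1,3)[of "phase_iter M f \<theta>0 n"] f \<theta>(2) decay by (simp add: phase_iter_def K_def)
    qed
    have "freq_error (phase_iter M f \<theta>0 (Suc m)) \<theta>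
        \<le> ennreal (T p / 2) + ennreal (1 / 2) * freq_error (phase_iter M f \<theta>0 m) \<theta>"
      using step(2)[of "phase_iter M f \<theta>0 m"] inv[of m] f \<theta>(2) decay by (simp add: phase_iter_def K_def)
    \<comment> \<open>\<open>T p / 2\<close> is the \<open>M0\<close> term of the claim, and the
      power of \<open>num_periods \<theta> / 4\<close> is nonnegative.\<close>
    also have "\<dots> \<le> ennreal (1 * (num_periods \<theta> / 4) powr (- p + 2) + 1/2 * C0 * real M powr (- p + 1))
        + ennreal (1/2) * freq_error (phase_iter M f \<theta>0 m) \<theta>"
      by (intro add_mono ennreal_leI order_refl) (simp add: T_def)
    finally show ?thesis .
  qed
  show ?thesis
    unfolding M_def[symmetric]
    by (rule exI[of _ 1], rule conjI, simp, intro allI impI, rule_tac x = "L0 p" in exI,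
        intro allI impI, rule bound; assumption)
qed

end
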